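(* There exist absolute constants $C,c_1>0$ such that the following holds. Let $\Phi:\mathbb{R}^d\to\mathbb{R}$ be a random ReLU network of width $N$ with $L$ hidden layers as described in the context (symmetric bias distributions), and let $k=\min\{d,N\}$. Then for all $u,t\ge0$, $$\mathrm{Lip}(\Phi)\ge\Big(\Big(1-\frac{C(\sqrt d+u)}{\sqrt N}\Big)_+\Big)^L(\sqrt k-t)$$ with probability at least $\big((1-2^{-N}-\exp(-u^2))_+\big)^L(1-2\exp(-c_1t^2))_+$.
   Context: The network is $\Phi = V^{(L)}\circ\mathrm{ReLU}\circ\cdots\circ\mathrm{ReLU}\circ V^{(0)}$, $V^{(\ell)}(x)=W^{(\ell)}x+b^{(\ell)}$, $\mathrm{ReLU}(t)=\max\{0,t\}$ componentwise, with $W^{(0)}\in\mathbb{R}^{N\times d}$, $W^{(\ell)}\in\mathbb{R}^{N\times N}$ ($1\le\ell\le L-1$), $W^{(L)}\in\mathbb{R}^{1\times N}$, $b^{(\ell)}\in\mathbb{R}^N$ ($\ell<L$), $b^{(L)}\in\mathbb{R}$; entries of $W^{(\ell)}$, $\ell<L$, i.i.d. $\mathcal{N}(0,2/N)$; entries of $W^{(L)}$ i.i.d. $\mathcal{N}(0,1)$; $b^{(\ell)}_i\sim\mathcal{D}^{(\ell)}_i$ with each $\mathcal{D}^{(\ell)}_i$ a symmetric probability distribution on $\mathbb{R}$; all jointly independent. $\mathrm{Lip}(f)=\sup_{x\neq y}|f(x)-f(y)|/\|x-y\|_2$; $a_+=\max\{0,a\}$. *)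

theory Defs
  imports "HOL-Probability.Probability"
begin

text \<open>Index of a random parameter of the network:
  Wt l i j is the entry (i,j) of the weight matrix W^(l), Bs l i is the entry i of b^(l).
  The output layer l = L uses row index i = 0 only.\<close>
datatype param = Wt nat nat nat | Bs nat nat

definition relu :: "real \<Rightarrow> real" where
  "relu t = max 0 t"

fun pre :: "nat \<Rightarrow> nat \<Rightarrow> (param \<Rightarrow> real) \<Rightarrow> (nat \<Rightarrow> real) \<Rightarrow> nat \<Rightarrow> nat \<Rightarrow> real" where
  "pre d N w x 0 i = (\<Sum>j<d. w (Wt 0 i j) * x j) + w (Bs 0 i)"
| "pre d N w x (Suc l) i = (\<Sum>j<N. w (Wt (Suc l) i j) * relu (pre d N w x l j)) + w (Bs (Suc l) i)"

definition net :: "nat \<Rightarrow> nat \<Rightarrow> nat \<Rightarrow> (param \<Rightarrow> real) \<Rightarrow> (nat \<Rightarrow> real) \<Rightarrow> real" where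
  "net d N L w x = pre d N w x L 0"

definition Rvec :: "nat \<Rightarrow> (nat \<Rightarrow> real) set" where
  "Rvec d = PiE {..<d} (\<lambda>_. UNIV)"

definition enorm :: "nat \<Rightarrow> (nat \<Rightarrow> real) \<Rightarrow> real" where
  "enorm d x = sqrt (\<Sum>j<d. (x j)\<^sup>2)"

definition Lip :: "nat \<Rightarrow> ((nat \<Rightarrow> real) \<Rightarrow> real) \<Rightarrow> ereal" where
  "Lip d f = Sup {ereal (\<bar>f x - f y\<bar> / enorm d (\<lambda>j. x j - y j)) | x y.
                    x \<in> Rvec d \<and> y \<in> Rvec d \<and> x \<noteq> y}"

definition params :: "nat \<Rightarrow> nat \<Rightarrow> nat \<Rightarrow> param set" where
  "params d N L =
     {Wt 0 i j | i j. i < N \<and> j < d}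
   \<union> {Wt l i j | l i j. 1 \<le> l \<and> l < L \<and> i < N \<and> j < N}
   \<union> {Wt L 0 j | j. j < N}
   \<union> {Bs l i | l i. l < L \<and> i < N}
   \<union> {Bs L 0}"

definition gauss :: "real \<Rightarrow> real measure" where
  "gauss s = density lborel (normal_density 0 s)"

fun param_dist :: "nat \<Rightarrow> nat \<Rightarrow> (nat \<Rightarrow> nat \<Rightarrow> real measure) \<Rightarrow> param \<Rightarrow> real measure" where
  "param_dist N L D (Wt l i j) = (if l < L then gauss (sqrt (2 / real N)) else gauss 1)"
| "param_dist N L D (Bs l i) = D l i"

definition net_law :: "nat \<Rightarrow> nat \<Rightarrow> nat \<Rightarrow> (nat \<Rightarrow> nat \<Rightarrow> real measure) \<Rightarrow> (param \<Rightarrow> real) measure" where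
  "net_law d N L D = PiM (params d N L) (param_dist N L D)"

definition symmetric_dist :: "real measure \<Rightarrow> bool" where
  "symmetric_dist M \<longleftrightarrow> prob_space M \<and> sets M = sets borel \<and> distr M borel uminus = M"

end

(* Fix a nonzero input x0. Flipping the sign of all weights and biases preserves the law and exchanges
   active and inactive neurons, so for a fixed vector y of squared norm 2 or less the energy
   sum over active i of (w_i . y)^2 has the moment generating function of a Gaussian chaos thinned by
   fair coins, and concentrates around |y|^2. A grid of C^d points in orthonormal coordinates of the
   d-dimensional image of the previous layers upgrades this to all y in the image. Hence every layer
   shrinks the differential at x0 by a factor of 1 - C(sqrt d + u)/sqrt N at worst, with conditional
   probability at least 1 - exp(-u^2). At the output, |A^T g| with g Gaussian is bounded below by a Chernoff
   bound for its Laplace transform. Since almost surely no pre-activation vanishes at x0, the network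
   is affine near x0 and its Lipschitz constant dominates the gradient norm. If the claimed lower
   bound is not positive, there is nothing to prove. *)
theory Submission
  imports Defs
begin

section \<open>Gaussian linear forms\<close>

text \<open>The activity pattern of a layer is built from the same weights whose action it
  restricts, so the active rows cannot be treated as independent Gaussian rows. What survives is an
  identity for one neuron and one fixed y: with Y = w_i . y, E exp (l * 1_active * Y^2) = (1 + E exp
  (l * Y^2)) / 2. It rests on an almost surely nonzero pre-activation, which a nonzero layer input
  provides even when biases have atoms. No extra event secures that input: were all activations
  zero, the differential would vanish, against the lower bound already established for the layers
  below. The weight variance 2/N undoes the factor 1/2, so the mean energy is |y|^2. The grid has
  dimension d rather than N, so the union bound pays 96^d against exp (- N r^2 / 128); r of order
  (sqrt d + u) / sqrt N balances the two. Conditioning on lower layers is a Fubini argument over the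
  finite product of parameter laws. The probabilistic part is reached only if 1 - C (sqrt d + u) /
  sqrt N is positive; this forces d < N, so there k = d.\<close>

lemma indep_vars_PiM_coordinates:
  assumes "finite I" "\<And>i. i \<in> I \<Longrightarrow> prob_space (M i)"
  shows "prob_space.indep_vars (PiM I M) M (\<lambda>i \<omega>. \<omega> i) I"
proof -
  interpret prob_space "PiM I M" using assms by (intro prob_space_PiM) auto
  show ?thesis
  proof (cases "I = {}")
    case True
    show ?thesis unfolding indep_vars_def indep_sets_def by (simp add: True)
  next
    case False
    have "distr (PiM I M) (PiM I M) (\<lambda>x. \<lambda>i\<in>I. x i) = distr (PiM I M) (PiM I M) (\<lambda>x. x)"
      by (intro distr_cong) (auto simp: space_PiM PiE_def extensional_restrict)
    also have "\<dots> = PiM I M"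
      by (rule distr_id2) simp
    also have "\<dots> = PiM I (\<lambda>i. distr (PiM I M) (M i) (\<lambda>\<omega>. \<omega> i))"
      by (intro PiM_cong) (auto simp: distr_PiM_component assms)
    finally show ?thesis
      using False by (subst indep_vars_iff_distr_eq_PiM') auto
  qed
qed

lemma sets_gauss [simp, measurable_cong]: "sets (gauss s) = sets borel"
  and space_gauss [simp]: "space (gauss s) = UNIV"
  by (auto simp: gauss_def)

lemma prob_space_gauss: "s > 0 \<Longrightarrow> prob_space (gauss s)"
  unfolding gauss_def by (rule prob_space_normal_density)

lemma distributed_gauss_linear_form:
  assumes K: "finite K" "\<And>i. i \<in> K \<Longrightarrow> prob_space (M i)"
    and I: "I \<subseteq> K" "\<And>i. i \<in> I \<Longrightarrow> M i = gauss s" and s: "s > 0"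
    and c: "(\<Sum>i\<in>I. (c i)\<^sup>2) > 0"
  shows "distributed (PiM K M) lborel (\<lambda>\<omega>. \<Sum>i\<in>I. c i * \<omega> i) (normal_density 0 (s * sqrt (\<Sum>i\<in>I. (c i)\<^sup>2)))"
proof -
  interpret prob_space "PiM K M" using K by (intro prob_space_PiM) auto
  \<comment> \<open>Adding independent normals with \<open>sum_indep_normal\<close> asks for
    positive standard deviations, so zero coefficients are dropped first.\<close>
  define J where "J = {i\<in>I. c i \<noteq> 0}"
  have fI: "finite I" using I K finite_subset by blast
  have J: "J \<subseteq> I" "finite J" using fI by (auto simp: J_def)
  have sum: "(\<Sum>i\<in>I. f i) = (\<Sum>i\<in>J. f i)" if "\<And>i. c i = 0 \<Longrightarrow> f i = 0" for f :: "_ \<Rightarrow> real"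
    using that fI by (intro sum.mono_neutral_right) (auto simp: J_def)
  have "J \<noteq> {}" using c sum[of "\<lambda>i. (c i)\<^sup>2"] by force
  have coord: "distributed (PiM K M) lborel (\<lambda>\<omega>. \<omega> i) (normal_density 0 s)" if "i \<in> J" for i
  proof -
    have i: "i \<in> K" "M i = gauss s" using that J I by auto
    have "distr (PiM K M) lborel (\<lambda>\<omega>. \<omega> i) = distr (PiM K M) (M i) (\<lambda>\<omega>. \<omega> i)"
      using i by (intro distr_cong) auto
    also have "\<dots> = gauss s" using i K distr_PiM_component[of K M i] by simp
    finally show ?thesis
      using i by (auto simp: distributed_def gauss_def intro!: measurable_compose[OF measurable_component_singleton[of i]])
  qed
  have "distributed (PiM K M) lborel (\<lambda>\<omega>. \<Sum>i\<in>J. c i * \<omega> i)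
     (normal_density (\<Sum>i\<in>J. 0) (sqrt (\<Sum>i\<in>J. (\<bar>c i\<bar> * s)\<^sup>2)))"
  proof (intro sum_indep_normal)
    have "indep_vars M (\<lambda>i \<omega>. \<omega> i) J"
      using indep_vars_PiM_coordinates[of K M, OF K] J I by (blast intro: indep_vars_subset)
    then show "indep_vars (\<lambda>i. borel) (\<lambda>i \<omega>. c i * \<omega> i) J"
      using J I by (rule_tac indep_vars_compose2[where M' = M and Y = "\<lambda>i x. c i * x"]) auto
    show "distributed (Pi\<^sub>M K M) lborel (\<lambda>\<omega>. c i * \<omega> i) (normal_density 0 (\<bar>c i\<bar> * s))" if "i \<in> J" for i
      using normal_density_affine[OF coord[OF that] s, of "c i" 0] that by (auto simp: J_def)
  qed (use J \<open>J \<noteq> {}\<close> s in \<open>auto simp: J_def\<close>)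
  moreover have "sqrt (\<Sum>i\<in>J. (\<bar>c i\<bar> * s)\<^sup>2) = s * sqrt (\<Sum>i\<in>I. (c i)\<^sup>2)"
    using s by (simp add: power_mult_distrib flip: sum_distrib_right) (simp add: sum real_sqrt_mult)
  moreover have "(\<lambda>\<omega>. \<Sum>i\<in>J. c i * \<omega> i) = (\<lambda>\<omega>. \<Sum>i\<in>I. c i * \<omega> i)"
    by (auto simp: sum)
  ultimately show ?thesis by simp
qed

text \<open>Multiplying the density of N(0, s^2) by exp (l x^2) yields 1/r times the density of N(0,
  (s/r)^2), where r^2 = 1 - 2 l s^2; the latter has mass 1.\<close>

lemma nn_integral_exp_square_normal:
  assumes "distributed M lborel Z (normal_density 0 s)" "s > 0" "2 * l * s\<^sup>2 < 1"
  shows "(\<integral>\<^sup>+ w. ennreal (exp (l * (Z w)\<^sup>2)) \<partial>M) = ennreal (1 / sqrt (1 - 2 * l * s\<^sup>2))"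
proof -
  define r where "r = sqrt (1 - 2 * l * s\<^sup>2)"
  have r: "r > 0" "r\<^sup>2 = 1 - 2 * l * s\<^sup>2" using assms by (auto simp: r_def)
  have eq: "normal_density 0 s x * exp (l * x\<^sup>2) = 1 / r * normal_density 0 (s / r) x" for x
  proof -
    have "- (x\<^sup>2 / (2 * s\<^sup>2)) + l * x\<^sup>2 = - (x\<^sup>2 / (2 * (s / r)\<^sup>2))"
      using assms(2) r(1) unfolding power_divide r(2) by (simp add: field_simps)
    then show ?thesis
      using assms(2) r(1) by (simp add: normal_density_def power_divide real_sqrt_divide real_sqrt_mult flip: exp_add)
  qed
  have "(\<integral>\<^sup>+ w. ennreal (exp (l * (Z w)\<^sup>2)) \<partial>M) = (\<integral>\<^sup>+ x. ennreal (normal_density 0 s x) * ennreal (exp (l * x\<^sup>2)) \<partial>lborel)"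
    using distributed_nn_integral[OF assms(1), of "\<lambda>x. ennreal (exp (l * x\<^sup>2))"] by simp
  also have "\<dots> = (\<integral>\<^sup>+ x. ennreal (1 / r) * ennreal (normal_density 0 (s / r) x) \<partial>lborel)"
    using r assms(2) by (intro nn_integral_cong) (simp add: eq ennreal_mult''[symmetric] flip: ennreal_mult')
  also have "\<dots> = ennreal (1 / r) * (\<integral>\<^sup>+ x. ennreal (normal_density 0 (s / r) x) \<partial>lborel)"
    by (intro nn_integral_cmult) auto
  also have "(\<integral>\<^sup>+ x. ennreal (normal_density 0 (s / r) x) \<partial>lborel) = 1"
  proof -
    interpret prob_space "density lborel (normal_density 0 (s / r))"
      using r assms by (intro prob_space_normal_density) auto
    show ?thesis using emeasure_space_1 by (simp add: emeasure_density)
  qed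
  finally show ?thesis by (simp add: r_def)
qed

lemma expectation_cos_normal:
  assumes "distributed M lborel Z (normal_density 0 s)" "s > 0"
  shows "(\<integral>w. cos (Z w) \<partial>M) = exp (- s\<^sup>2 / 2)"
proof -
  have "(\<integral>w. cos (Z w) \<partial>M) = (\<integral>x. normal_density 0 s x * cos x \<partial>lborel)"
    using distributed_integral[OF assms(1), of cos] assms by (simp add: normal_density_nonneg)
  also have "\<dots> = \<bar>s\<bar> * (\<integral>x. normal_density 0 s (0 + s * x) * cos (0 + s * x) \<partial>lborel)"
    using assms(2) lborel_integral_real_affine[of s "\<lambda>x. normal_density 0 s x * cos x" 0] by simp
  also have "\<dots> = (\<integral>x. std_normal_density x * cos (s * x) \<partial>lborel)"
    using assms(2) unfolding integral_mult_right_zero[symmetric]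
    by (intro Bochner_Integration.integral_cong)
      (auto simp: normal_density_def power_mult_distrib real_sqrt_mult)
  also have "\<dots> = (\<integral>x. cos (s * x) \<partial>std_normal_distribution)"
    by (subst integral_density) auto
  also have "\<dots> = Re (char std_normal_distribution s)"
  proof -
    interpret prob_space std_normal_distribution by (rule real_dist_normal_dist[THEN real_distribution.axioms(1)])
    show ?thesis unfolding char_def
      by (subst integral_Re[symmetric]) (auto intro!: integrable_const_bound[where B = 1] simp: Re_exp)
  qed
  also have "\<dots> = exp (- s\<^sup>2 / 2)"
    by (simp add: char_std_normal_distribution)
  finally show ?thesis .
qed

section \<open>Gram-Schmidt and nets of Euclidean balls\<close>

definition ip :: "nat \<Rightarrow> (nat \<Rightarrow> real) \<Rightarrow> (nat \<Rightarrow> real) \<Rightarrow> real" where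
  "ip n x y = (\<Sum>j<n. x j * y j)"

lemma ip_commute: "ip n x y = ip n y x"
  by (simp add: ip_def mult.commute)

lemma ip_self_nonneg [simp]: "ip n x x \<ge> 0"
  by (auto simp: ip_def intro: sum_nonneg)

lemma ip_self_eq_0_iff: "ip n x x = 0 \<longleftrightarrow> (\<forall>j<n. x j = 0)"
  by (auto simp: ip_def sum_nonneg_eq_0_iff)

lemma ip_add_left: "ip n (\<lambda>j. x j + y j) z = ip n x z + ip n y z"
  and ip_diff_left: "ip n (\<lambda>j. x j - y j) z = ip n x z - ip n y z"
  and ip_scale_left: "ip n (\<lambda>j. a * x j) z = a * ip n x z"
  and ip_divide_left: "ip n (\<lambda>j. x j / a) z = ip n x z / a"
  by (simp_all add: ip_def algebra_simps sum.distrib sum_subtractf sum_distrib_left sum_divide_distrib)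

lemma ip_sum_left: "ip n (\<lambda>j. \<Sum>k\<in>K. a k * x k j) z = (\<Sum>k\<in>K. a k * ip n (x k) z)"
proof -
  have "ip n (\<lambda>j. \<Sum>k\<in>K. a k * x k j) z = (\<Sum>j<n. \<Sum>k\<in>K. a k * (x k j * z j))"
    by (simp add: ip_def sum_distrib_right mult.assoc)
  also have "\<dots> = (\<Sum>k\<in>K. \<Sum>j<n. a k * (x k j * z j))" by (rule sum.swap)
  finally show ?thesis by (simp add: ip_def sum_distrib_left)
qed

lemma ip_add_right: "ip n z (\<lambda>j. x j + y j) = ip n z x + ip n z y"
  and ip_diff_right: "ip n z (\<lambda>j. x j - y j) = ip n z x - ip n z y"
  and ip_scale_right: "ip n z (\<lambda>j. a * x j) = a * ip n z x"
  and ip_divide_right: "ip n z (\<lambda>j. x j / a) = ip n z x / a"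
  and ip_sum_right: "ip n z (\<lambda>j. \<Sum>k\<in>K. b k * v k j) = (\<Sum>k\<in>K. b k * ip n z (v k))"
  by (simp_all add: ip_commute[of n z] ip_add_left ip_diff_left ip_scale_left ip_divide_left ip_sum_left)

text \<open>Vanishing vectors \<open>e k\<close> are allowed, so that \<open>a\<close> need not be linearly independent.\<close>
lemma gram_schmidt:
  fixes a :: "nat \<Rightarrow> nat \<Rightarrow> real"
  shows "\<exists>e. (\<forall>k<d. \<forall>l<d. k \<noteq> l \<longrightarrow> ip n (e k) (e l) = 0) \<and>
             (\<forall>k<d. ip n (e k) (e k) = 0 \<or> ip n (e k) (e k) = 1) \<and>
             (\<forall>k<d. \<forall>j<n. a k j = (\<Sum>m<d. ip n (a k) (e m) * e m j))"
proof (induction d)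
  case (Suc d)
  then obtain e where e: "\<forall>k<d. \<forall>l<d. k \<noteq> l \<longrightarrow> ip n (e k) (e l) = 0"
    "\<forall>k<d. ip n (e k) (e k) = 0 \<or> ip n (e k) (e k) = 1"
    "\<forall>k<d. \<forall>j<n. a k j = (\<Sum>m<d. ip n (a k) (e m) * e m j)"
    by (elim exE conjE)
  have orth: "ip n (e k) (e l) = 0" if "k < d" "l < d" "k \<noteq> l" for k l
    using e(1) that by simp
  have nrm: "ip n (e k) (e k) = 0 \<or> ip n (e k) (e k) = 1" if "k < d" for k
    using e(2) that by simp
  have span: "a k j = (\<Sum>m<d. ip n (a k) (e m) * e m j)" if "k < d" "j < n" for k j
    using e(3) that by blast
  define r where "r = (\<lambda>j. a d j - (\<Sum>m<d. ip n (a d) (e m) * e m j))"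
  \<comment> \<open>If \<open>r\<close> vanishes, division by zero makes \<open>f\<close> vanish
    too; a linearly dependent \<open>a d\<close> thus contributes a zero vector.\<close>
  define f where "f = (\<lambda>j. r j / sqrt (ip n r r))"
  have r_orth: "ip n r (e l) = 0" if "l < d" for l
  proof -
    have "(\<Sum>m<d. ip n (a d) (e m) * ip n (e m) (e l)) = (\<Sum>m<d. if m = l then ip n (a d) (e l) * ip n (e l) (e l) else 0)"
      by (rule sum.cong) (simp_all add: orth that)
    also have "\<dots> = ip n (a d) (e l) * ip n (e l) (e l)" using that by simp
    also have "\<dots> = ip n (a d) (e l)"
      using nrm[OF that]
    proof
      assume "ip n (e l) (e l) = 0"
      then have "\<forall>j<n. e l j = 0" by (simp add: ip_self_eq_0_iff)
      then show ?thesis by (simp add: ip_def)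
    qed simp
    finally show ?thesis
      unfolding r_def ip_diff_left ip_sum_left by simp
  qed
  have f_orth: "ip n f (e l) = 0" if "l < d" for l
    using r_orth[OF that] by (simp add: f_def ip_divide_left)
  have ff: "ip n f f = ip n r r / (sqrt (ip n r r))\<^sup>2"
    unfolding f_def ip_divide_left ip_divide_right by (simp add: power2_eq_square)
  have ff01: "ip n f f = 0 \<or> ip n f f = 1"
    unfolding ff by auto
  have r_f: "ip n (a d) f * f j = r j" if "j < n" for j
  proof -
    have "ip n (\<lambda>j. \<Sum>m<d. ip n (a d) (e m) * e m j) r = 0"
      unfolding ip_sum_left using r_orth by (simp add: ip_commute)
    then have "ip n r r = ip n (a d) r"
      using ip_diff_left[of n "a d" "\<lambda>j. \<Sum>m<d. ip n (a d) (e m) * e m j" r] by (simp add: flip: r_def)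
    then have "ip n (a d) f = ip n r r / sqrt (ip n r r)"
      unfolding f_def ip_divide_right by simp
    then have "ip n (a d) f * f j = r j * (ip n r r / (sqrt (ip n r r))\<^sup>2)"
      by (simp add: f_def power2_eq_square)
    then show ?thesis
      using that ip_self_eq_0_iff[of n r] by (cases "ip n r r = 0") auto
  qed
  have a_f: "ip n (a k) f = 0" if "k < d" for k
  proof -
    have "ip n (a k) f = ip n (\<lambda>j. \<Sum>m<d. ip n (a k) (e m) * e m j) f"
      unfolding ip_def[of n _ f] using span[OF that] by (intro sum.cong) auto
    also have "\<dots> = 0"
      unfolding ip_sum_left using f_orth by (simp add: ip_commute)
    finally show ?thesis .
  qed
  define e' where "e' = e(d := f)"
  have e': "e' d = f" "\<And>k. k < d \<Longrightarrow> e' k = e k" by (auto simp: e'_def)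
  show ?case
  proof (intro exI[of _ e'] conjI allI impI)
    fix k l assume "k < Suc d" "l < Suc d" "k \<noteq> l"
    then show "ip n (e' k) (e' l) = 0"
      using orth f_orth by (cases "k = d"; cases "l = d") (auto simp: e' ip_commute)
  next
    fix k assume "k < Suc d"
    then show "ip n (e' k) (e' k) = 0 \<or> ip n (e' k) (e' k) = 1"
      using nrm ff01 by (cases "k = d") (auto simp: e')
  next
    fix k j assume k: "k < Suc d" and j: "j < n"
    have "(\<Sum>m<Suc d. ip n (a k) (e' m) * e' m j) = (\<Sum>m<d. ip n (a k) (e m) * e m j) + ip n (a k) f * f j"
      by (simp add: e')
    also have "\<dots> = a k j"
    proof (cases "k = d")
      case True
      then show ?thesis using r_f[OF j] by (simp add: r_def)
    next
      case False
      then have "k < d" using k by simp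
      then show ?thesis using span[OF \<open>k < d\<close> j] by (simp add: a_f)
    qed
    finally show "a k j = (\<Sum>m<Suc d. ip n (a k) (e' m) * e' m j)" by simp
  qed
qed auto

text \<open>Counting with the weight \<open>2 ^ (R d - |z|)\<close>, which is at least 1 on the ball and factorises over coordinates.\<close>
lemma card_integer_ball:
  fixes R d :: nat
  defines "Z \<equiv> {z \<in> PiE {..<d} (\<lambda>_. UNIV :: int set). (\<Sum>k<d. \<bar>z k\<bar>) \<le> int (R * d)}"
  shows "finite Z" "real (card Z) \<le> (3 * 2 ^ R) ^ d"
proof -
  define n where "n = R * d"
  define B where "B = {- int n..int n}"
  have sub: "Z \<subseteq> PiE {..<d} (\<lambda>_. B)"
  proof
    fix z assume z: "z \<in> Z"
    have "\<bar>z k\<bar> \<le> int n" if "k < d" for k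
    proof -
      have "\<bar>z k\<bar> \<le> (\<Sum>k<d. \<bar>z k\<bar>)" using that by (intro member_le_sum) auto
      then show ?thesis using z by (auto simp: Z_def n_def)
    qed
    then have "z k \<in> B" if "k < d" for k
      using that unfolding B_def atLeastAtMost_iff by (metis abs_le_iff minus_le_iff)
    then show "z \<in> PiE {..<d} (\<lambda>_. B)" using z by (simp add: Z_def PiE_iff)
  qed
  have fin: "finite (PiE {..<d} (\<lambda>_. B))" by (intro finite_PiE) (auto simp: B_def)
  show finZ: "finite Z" using sub fin finite_subset by blast
  \<comment> \<open>The two-sided geometric series: nonnegative \<open>m\<close> contribute at most
    2, negative \<open>m\<close> at most 1.\<close>
  have B3: "(\<Sum>m\<in>B. (1 / 2) ^ nat \<bar>m\<bar>) \<le> (3::real)"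
  proof -
    have "B \<subseteq> int ` {..n} \<union> (\<lambda>i. - int i) ` {1..n}"
    proof
      fix m assume m: "m \<in> B"
      show "m \<in> int ` {..n} \<union> (\<lambda>i. - int i) ` {1..n}"
      proof (cases "m \<ge> 0")
        case True
        then have "m = int (nat m)" "nat m \<le> n" using m by (auto simp: B_def)
        then show ?thesis by blast
      next
        case False
        then have "m = - int (nat (- m))" "1 \<le> nat (- m)" "nat (- m) \<le> n" using m by (auto simp: B_def)
        then show ?thesis by (metis UnI2 atLeastAtMost_iff imageI)
      qed
    qed
    then have "(\<Sum>m\<in>B. (1 / 2) ^ nat \<bar>m\<bar>) \<le> (\<Sum>m\<in>int ` {..n} \<union> (\<lambda>i. - int i) ` {1..n}. (1 / 2::real) ^ nat \<bar>m\<bar>)"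
      by (intro sum_mono2) auto
    also have "\<dots> \<le> (\<Sum>m\<in>int ` {..n}. (1 / 2::real) ^ nat \<bar>m\<bar>) + (\<Sum>m\<in>(\<lambda>i. - int i) ` {1..n}. (1 / 2) ^ nat \<bar>m\<bar>)"
      by (subst sum_Un) (auto intro: sum_nonneg)
    also have "\<dots> = (\<Sum>i\<le>n. (1 / 2) ^ i) + (\<Sum>i\<in>{1..n}. (1 / 2) ^ i)"
      by (subst (1 2) sum.reindex) (auto simp: inj_on_def)
    also have "(\<Sum>i\<le>n. (1 / 2::real) ^ i) \<le> 2"
      by (simp add: sum_gp0)
    also have "(\<Sum>i\<in>{1..n}. (1 / 2::real) ^ i) \<le> 1"
      by (simp add: sum_gp)
    finally show ?thesis by simp
  qed
  have "real (card Z) = (\<Sum>z\<in>Z. 1)" by simp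
  also have "\<dots> \<le> (\<Sum>z\<in>Z. 2 ^ (R * d) * (\<Prod>k<d. (1 / 2) ^ nat \<bar>z k\<bar>))"
  proof (rule sum_mono)
    fix z assume "z \<in> Z"
    then have "(\<Sum>k<d. nat \<bar>z k\<bar>) \<le> R * d"
      by (auto simp: Z_def simp flip: of_nat_le_iff[where 'a = int])
    then have "(1 / 2 :: real) ^ (R * d) \<le> (1 / 2) ^ (\<Sum>k<d. nat \<bar>z k\<bar>)"
      by (intro power_decreasing) auto
    also have "\<dots> = (\<Prod>k<d. (1 / 2) ^ nat \<bar>z k\<bar>)" by (simp add: power_sum)
    finally show "1 \<le> 2 ^ (R * d) * (\<Prod>k<d. (1 / 2 :: real) ^ nat \<bar>z k\<bar>)"
      by (simp add: power_divide field_simps)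
  qed
  also have "\<dots> \<le> (\<Sum>z\<in>PiE {..<d} (\<lambda>_. B). 2 ^ (R * d) * (\<Prod>k<d. (1 / 2) ^ nat \<bar>z k\<bar>))"
    by (rule sum_mono2[OF fin sub]) (simp add: prod_nonneg)
  also have "\<dots> = 2 ^ (R * d) * (\<Prod>k<d. \<Sum>m\<in>B. (1 / 2) ^ nat \<bar>m\<bar>)"
    using prod_sum_PiE[of "{..<d}" "\<lambda>_. B" "\<lambda>_ m. (1 / 2 :: real) ^ nat \<bar>m\<bar>"]
    by (simp add: B_def sum_distrib_left del: prod_constant)
  also have "\<dots> \<le> 2 ^ (R * d) * (\<Prod>k<d. 3)"
    by (rule mult_left_mono[OF prod_mono]) (simp_all add: B3 sum_nonneg)
  also have "\<dots> = (3 * 2 ^ R) ^ d"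
    by (simp add: power_mult power_mult_distrib)
  finally show "real (card Z) \<le> (3 * 2 ^ R) ^ d" .
qed

text \<open>The points \<open>z / (4 * sqrt d)\<close> with \<open>z\<close> in the grid form a \<open>1/4\<close>-net of the unit sphere of \<open>\<real>\<^sup>d\<close>:
  rounding down costs at most \<open>1/4\<close> in norm, and \<open>25 d = (5/4)\<^sup>2 (4 sqrt d)\<^sup>2\<close>.\<close>
definition grid :: "nat \<Rightarrow> (nat \<Rightarrow> int) set" where
  "grid d = {z \<in> PiE {..<d} (\<lambda>_. UNIV). (\<Sum>k<d. (real_of_int (z k))\<^sup>2) \<le> 25 * real d}"

text \<open>By (|z k| - 5)^2 >= 0, |z k| <= ((z k)^2 + 25) / 10. Summing over k places the grid in
  the l1 ball of radius 5 d, and 96 = 3 * 2^5.\<close>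

lemma finite_grid: "finite (grid d)" and card_grid: "real (card (grid d)) \<le> 96 ^ d"
proof -
  let ?Z = "{z \<in> PiE {..<d} (\<lambda>_. UNIV :: int set). (\<Sum>k<d. \<bar>z k\<bar>) \<le> int (5 * d)}"
  have "grid d \<subseteq> ?Z"
  proof
    fix z assume z: "z \<in> grid d"
    have "real_of_int \<bar>z k\<bar> \<le> ((real_of_int (z k))\<^sup>2 + 25) / 10" for k
      using zero_le_power2[of "\<bar>real_of_int (z k)\<bar> - 5"] by (simp add: power2_diff)
    then have "(\<Sum>k<d. real_of_int \<bar>z k\<bar>) \<le> (\<Sum>k<d. ((real_of_int (z k))\<^sup>2 + 25) / 10)"
      by (intro sum_mono)
    also have "\<dots> = ((\<Sum>k<d. (real_of_int (z k))\<^sup>2) + 25 * real d) / 10"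
      by (simp add: sum.distrib flip: sum_divide_distrib)
    also have "\<dots> \<le> real_of_int (int (5 * d))"
      using z by (simp add: grid_def)
    finally have "(\<Sum>k<d. \<bar>z k\<bar>) \<le> int (5 * d)"
      by (simp only: of_int_le_iff flip: of_int_sum)
    then show "z \<in> ?Z" using z by (simp add: grid_def)
  qed
  note sub = this
  show "finite (grid d)" using sub card_integer_ball(1)[where R = 5 and d = d] finite_subset by blast
  have "real (card (grid d)) \<le> real (card ?Z)"
    using card_mono[OF _ sub] card_integer_ball(1)[where R = 5 and d = d] by simp
  also have "\<dots> \<le> 96 ^ d" using card_integer_ball(2)[where R = 5 and d = d] by simp
  finally show "real (card (grid d)) \<le> 96 ^ d" .
qed

text \<open>A self-improving estimate for the best constant \<open>S\<close> of the form: rounding a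
  unit vector to the grid changes \<open>q\<close> by at most 9/16 * S, so S <= r + 9/16 * S, that
  is S <= 16/7 * r. Defining \<open>S\<close> as an infimum of admissible constants, not as a
  maximum over the sphere, avoids compactness.\<close>

lemma quadratic_form_bound_from_grid:
  fixes B :: "nat \<Rightarrow> nat \<Rightarrow> real" and r :: real and d :: nat
  defines "q \<equiv> \<lambda>c. \<Sum>k<d. \<Sum>l<d. B k l * c k * c l"
  assumes sym: "\<And>k l. k < d \<Longrightarrow> l < d \<Longrightarrow> B k l = B l k"
    and grid: "\<And>z. z \<in> grid d \<Longrightarrow> \<bar>q (\<lambda>k. z k / (4 * sqrt (real d)))\<bar> \<le> r"
  shows "\<bar>q c\<bar> \<le> 16 / 7 * r * ip d c c"
proof -
  define b where "b x y = (\<Sum>k<d. \<Sum>l<d. B k l * x k * y l)" for x y :: "nat \<Rightarrow> real"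
  define \<K> where "\<K> = {K. K \<ge> 0 \<and> (\<forall>c. \<bar>q c\<bar> \<le> K * ip d c c)}"
  have r0: "r \<ge> 0"
  proof -
    have "restrict (\<lambda>_. 0) {..<d} \<in> grid d" by (auto simp: grid_def)
    from grid[OF this] show ?thesis by linarith
  qed
  have b_sym: "b x y = b y x" for x y
  proof -
    have "b x y = (\<Sum>k<d. \<Sum>l<d. B l k * x l * y k)" unfolding b_def by (rule sum.swap)
    also have "\<dots> = b y x" unfolding b_def
      by (intro sum.cong refl) (auto simp: sym mult_ac)
    finally show ?thesis .
  qed
  have q_b: "q x = b x x" for x by (simp add: q_def b_def)
  have b_lin: "b (\<lambda>k. x k + y k) z = b x z + b y z" "b (\<lambda>k. x k - y k) z = b x z - b y z"
      "b (\<lambda>k. a * x k) z = a * b x z" for x y z a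
    by (simp_all add: b_def algebra_simps sum.distrib sum_subtractf sum_distrib_left)
  have b_lin': "b z (\<lambda>k. x k + y k) = b z x + b z y" "b z (\<lambda>k. x k - y k) = b z x - b z y"
      "b z (\<lambda>k. a * x k) = a * b z x" for x y z a
    using b_lin b_sym by metis+
  have coord: "(x k)\<^sup>2 \<le> ip d x x" if "k < d" for x k
    unfolding ip_def using that member_le_sum[of k "{..<d}" "\<lambda>j. x j * x j"] by (auto simp: power2_eq_square)
  have ne: "\<K> \<noteq> {}"
  proof -
    have "(\<Sum>k<d. \<Sum>l<d. \<bar>B k l\<bar>) \<in> \<K>"
      unfolding \<K>_def
    proof (intro CollectI conjI allI sum_nonneg abs_ge_zero)
      fix c
      have "\<bar>q c\<bar> \<le> (\<Sum>k<d. \<Sum>l<d. \<bar>B k l * c k * c l\<bar>)"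
        unfolding q_def by (intro order_trans[OF sum_abs] sum_mono) auto
      also have "\<dots> \<le> (\<Sum>k<d. \<Sum>l<d. \<bar>B k l\<bar> * ip d c c)"
      proof (intro sum_mono)
        fix k l assume "k \<in> {..<d}" "l \<in> {..<d}"
        then have "(c k)\<^sup>2 \<le> ip d c c" "(c l)\<^sup>2 \<le> ip d c c" using coord by auto
        moreover have "\<bar>c k * c l\<bar> \<le> ((c k)\<^sup>2 + (c l)\<^sup>2) / 2"
          using sum_squares_bound[of "\<bar>c k\<bar>" "\<bar>c l\<bar>"] by (simp add: abs_mult)
        moreover have "((c k)\<^sup>2 + (c l)\<^sup>2) / 2 \<le> ip d c c" using calculation(1,2) by (simp add: field_simps)
        ultimately have "\<bar>c k * c l\<bar> \<le> ip d c c" by (rule_tac order_trans)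
        then show "\<bar>B k l * c k * c l\<bar> \<le> \<bar>B k l\<bar> * ip d c c"
          by (simp add: abs_mult mult.assoc mult_left_mono)
      qed
      finally show "\<bar>q c\<bar> \<le> (\<Sum>k<d. \<Sum>l<d. \<bar>B k l\<bar>) * ip d c c"
        by (simp add: sum_distrib_right)
    qed
    then show ?thesis by auto
  qed
  define S where "S = Inf \<K>"
  have bdd: "bdd_below \<K>" by (auto simp: \<K>_def)
  have S0: "S \<ge> 0" unfolding S_def by (rule cInf_greatest[OF ne]) (auto simp: \<K>_def)
  have \<K>D: "\<bar>q c\<bar> \<le> K * ip d c c" if "K \<in> \<K>" for K c
    using that unfolding \<K>_def mem_Collect_eq by blast
  have S: "\<bar>q c\<bar> \<le> S * ip d c c" for c
  proof (cases "ip d c c = 0")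
    case True
    then show ?thesis using ne \<K>D[of _ c] by auto
  next
    case False
    then have pos: "ip d c c > 0" using ip_self_nonneg[of d c] by linarith
    have "\<bar>q c\<bar> / ip d c c \<le> S" unfolding S_def
      using pos \<K>D[of _ c] by (intro cInf_greatest[OF ne]) (simp add: field_simps)
    then show ?thesis using pos by (simp add: field_simps)
  qed
  \<comment> \<open>Polarisation, then the parallelogram law.\<close>
  have bS: "\<bar>b x y\<bar> \<le> S * (ip d x x + ip d y y) / 2" for x y
  proof -
    have "4 * b x y = q (\<lambda>k. x k + y k) - q (\<lambda>k. x k - y k)"
      by (simp add: q_b b_lin b_lin' b_sym)
    also have "\<bar>\<dots>\<bar> \<le> S * ip d (\<lambda>k. x k + y k) (\<lambda>k. x k + y k) + S * ip d (\<lambda>k. x k - y k) (\<lambda>k. x k - y k)"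
      using S by (intro order_trans[OF abs_triangle_ineq4] add_mono)
    also have "\<dots> = 2 * S * (ip d x x + ip d y y)"
      by (simp add: ip_add_left ip_diff_left ip_add_right ip_diff_right ip_commute algebra_simps)
    finally show ?thesis by (simp add: abs_mult)
  qed
  have unit: "\<bar>q c\<bar> \<le> r + 9 / 16 * S" if c1: "ip d c c = 1" for c
  proof -
    have d0: "d > 0" using c1 by (cases d) (auto simp: ip_def)
    define z where "z = restrict (\<lambda>k. \<lfloor>4 * sqrt d * c k\<rfloor>) {..<d}"
    define a where "a k = z k / (4 * sqrt d)" for k
    define \<rho> where "\<rho> k = c k - a k" for k
    have L2: "ip d x x = (L2_set x {..<d})\<^sup>2" for x
      by (simp add: ip_def L2_set_def sum_nonneg power2_eq_square)
    have \<rho>k: "(\<rho> k)\<^sup>2 \<le> 1 / (16 * d)" if "k < d" for k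
    proof -
      have "4 * sqrt d * \<rho> k = 4 * sqrt d * c k - \<lfloor>4 * sqrt d * c k\<rfloor>"
        using d0 that by (simp add: \<rho>_def a_def z_def field_simps)
      then have "0 \<le> 4 * sqrt d * \<rho> k" "4 * sqrt d * \<rho> k \<le> 1" by linarith+
      then have "(4 * sqrt d * \<rho> k)\<^sup>2 \<le> 1\<^sup>2" by (intro power_mono)
      then show ?thesis using d0 by (simp add: power_mult_distrib field_simps)
    qed
    have "ip d \<rho> \<rho> \<le> (\<Sum>k<d. 1 / (16 * real d))"
      unfolding ip_def using \<rho>k by (intro sum_mono) (auto simp: power2_eq_square)
    then have \<rho>\<rho>: "ip d \<rho> \<rho> \<le> 1 / 16" using d0 by simp
    then have L\<rho>: "L2_set \<rho> {..<d} \<le> 1 / 4"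
      unfolding L2 using power2_le_imp_le[of "L2_set \<rho> {..<d}" "1 / 4"] by (simp add: power2_eq_square)
    have Lc: "L2_set c {..<d} = 1"
      using c1 unfolding L2 by (simp add: power2_eq_1_iff L2_set_nonneg) (smt (verit) L2_set_nonneg)
    have "L2_set a {..<d} = L2_set (\<lambda>k. c k + (- \<rho> k)) {..<d}"
      by (simp add: \<rho>_def)
    also have "\<dots> \<le> L2_set c {..<d} + L2_set (\<lambda>k. - \<rho> k) {..<d}"
      by (rule L2_set_triangle_ineq)
    also have "L2_set (\<lambda>k. - \<rho> k) {..<d} = L2_set \<rho> {..<d}" by (simp add: L2_set_def)
    finally have La: "L2_set a {..<d} \<le> 5 / 4" using L\<rho> Lc by simp
    have "L2_set (\<lambda>k. a k + c k) {..<d} \<le> 9 / 4"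
      using L2_set_triangle_ineq[of a c "{..<d}"] La Lc by simp
    then have ac: "ip d (\<lambda>k. a k + c k) (\<lambda>k. a k + c k) \<le> 81 / 16"
      unfolding L2 using power_mono[of _ "9 / 4 :: real" 2] by (fastforce simp: power2_eq_square L2_set_nonneg)
    have "ip d a a \<le> 25 / 16"
      unfolding L2 using power_mono[OF La, of 2] by (simp add: power2_eq_square L2_set_nonneg)
    moreover have "ip d a a = (\<Sum>k<d. (real_of_int (z k))\<^sup>2) / (16 * d)"
      by (simp add: ip_def a_def power2_eq_square sum_divide_distrib)
    ultimately have "z \<in> grid d"
      using d0 by (auto simp: grid_def z_def field_simps)
    then have qa: "\<bar>q a\<bar> \<le> r" using grid by (simp add: a_def[abs_def])
    have "q c - q a = b \<rho> (\<lambda>k. a k + c k)"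
      unfolding q_b \<rho>_def b_lin b_lin' by (simp add: b_sym)
    \<comment> \<open>The scalings 3 and 1/3 balance the two squared norms: 9 * 1/16 and 1/9 * 81/16
      both equal 9/16.\<close>
    also have "\<dots> = b (\<lambda>k. 3 * \<rho> k) (\<lambda>k. 1 / 3 * (a k + c k))"
      unfolding b_lin b_lin' by simp
    also have "\<bar>\<dots>\<bar> \<le> S * (9 * ip d \<rho> \<rho> + 1 / 9 * ip d (\<lambda>k. a k + c k) (\<lambda>k. a k + c k)) / 2"
      by (rule order_trans[OF bS]) (unfold ip_scale_left ip_scale_right, simp)
    also have "\<dots> \<le> S * (9 / 8) / 2"
      using \<rho>\<rho> ac S0 by (intro divide_right_mono mult_left_mono) auto
    finally show ?thesis using qa by linarith
  qed
  have "r + 9 / 16 * S \<in> \<K>"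
    unfolding \<K>_def
  proof (intro CollectI conjI allI)
    fix c show "\<bar>q c\<bar> \<le> (r + 9 / 16 * S) * ip d c c"
    proof (cases "ip d c c = 0")
      case False
      then have pos: "ip d c c > 0" using ip_self_nonneg[of d c] by linarith
      define t where "t = 1 / sqrt (ip d c c)"
      have t: "t * t = 1 / ip d c c" using pos by (simp add: t_def)
      have "ip d (\<lambda>k. t * c k) (\<lambda>k. t * c k) = t * t * ip d c c"
        unfolding ip_scale_left ip_scale_right by simp
      then have "ip d (\<lambda>k. t * c k) (\<lambda>k. t * c k) = 1"
        using pos by (simp add: t)
      then have "\<bar>q (\<lambda>k. t * c k)\<bar> \<le> r + 9 / 16 * S" by (rule unit)
      also have "q (\<lambda>k. t * c k) = t * t * q c"
        unfolding q_b b_lin b_lin' by simp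
      finally show ?thesis using pos by (simp add: t abs_mult field_simps)
    qed (use S[of c] in simp)
  qed (use r0 S0 in simp)
  then have "S \<le> r + 9 / 16 * S" unfolding S_def using bdd by (rule cInf_lower)
  then have "S \<le> 16 / 7 * r" by simp
  then show ?thesis
    using S[of c] mult_right_mono[of S "16 / 7 * r" "ip d c c"] by simp
qed

section \<open>Concentration in one layer\<close>

lemma symmetric_dist_gauss: "s > 0 \<Longrightarrow> symmetric_dist (gauss s)"
proof -
  assume s: "s > 0"
  have "gauss s = density (distr lborel borel uminus) (normal_density 0 s)"
    by (simp add: gauss_def lborel_distr_uminus)
  also have "\<dots> = distr (density lborel (\<lambda>x. normal_density 0 s (- x))) borel uminus"
    by (subst density_distr) auto
  also have "\<dots> = distr (gauss s) borel uminus"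
    by (simp add: gauss_def normal_density_def)
  finally show ?thesis
    using s by (simp add: symmetric_dist_def prob_space_gauss)
qed

lemma emeasure_gauss_singleton: "emeasure (gauss s) {x} = 0"
  by (simp add: gauss_def emeasure_density nn_integral_indicator_singleton)

section \<open>Products of symmetric distributions and the sign flip\<close>

locale symmetric_params = product_sigma_finite M for M :: "'i \<Rightarrow> real measure" +
  assumes symmetric: "\<And>k. symmetric_dist (M k)"
begin

lemma sets_M [simp, measurable_cong]: "sets (M k) = sets borel"
  using symmetric[of k] by (simp add: symmetric_dist_def)

lemma space_M [simp]: "space (M k) = UNIV"
  using sets_eq_imp_space_eq[OF sets_M[of k]] by simp

lemma prob_space_M: "prob_space (M k)"
  using symmetric[of k] by (simp add: symmetric_dist_def)

lemma prob_space_P: "prob_space (PiM K M)"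
  by (intro prob_space_PiM prob_space_M)

lemma coordinate_measurable [measurable]: "k \<in> K \<Longrightarrow> (\<lambda>w. w k) \<in> borel_measurable (PiM K M)"
  using measurable_component_singleton[of k K M] by (simp cong: measurable_cong_sets)

lemma distr_negate:
  assumes "finite K"
  shows "distr (PiM K M) (PiM K M) (\<lambda>w. \<lambda>k\<in>K. - w k) = PiM K M"
proof -
  have "distr (PiM K M) (PiM K M) (compose K uminus) = PiM K (\<lambda>k. distr (M k) (M k) uminus)"
    by (intro distr_PiM_finite_prob_space' assms prob_space_M) (subst measurable_cong_sets[OF sets_M sets_M], simp)
  also have "\<dots> = PiM K M"
  proof (intro PiM_cong refl)
    fix k
    have "distr (M k) (M k) uminus = distr (M k) borel uminus" by (intro distr_cong) auto
    then show "distr (M k) (M k) uminus = M k" using symmetric[of k] by (simp add: symmetric_dist_def)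
  qed
  also have "compose K uminus = (\<lambda>w. \<lambda>k\<in>K. - w k :: real)" by (auto simp: compose_def)
  finally show ?thesis .
qed

text \<open>The bias may have atoms, so the argument rests on one Gaussian weight with nonzero
  coefficient: once all other parameters are fixed, that weight has to avoid a single point.\<close>

lemma AE_affine_ne_0:
  assumes K: "finite K" "I \<subseteq> K" "b \<in> K" "b \<notin> I" and k: "k \<in> I" "M k = gauss s" "c k \<noteq> 0"
  shows "AE w in PiM K M. (\<Sum>i\<in>I. w i * c i) + w b \<noteq> 0"
proof -
  define f where "f w = (\<Sum>i\<in>I. w i * c i) + w b" for w :: "'i \<Rightarrow> real"
  have fI: "finite I" using K finite_subset by blast
  have f_meas [measurable]: "f \<in> borel_measurable (PiM K M)"
    unfolding f_def using K by (auto intro!: borel_measurable_add borel_measurable_sum borel_measurable_times)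
  let ?R = "K - {k}"
  have K': "insert k ?R = K" using K k by auto
  have "emeasure (PiM K M) {w\<in>space (PiM K M). f w = 0} = (\<integral>\<^sup>+ w. indicator {0} (f w) \<partial>PiM K M)"
  proof -
    have "(\<integral>\<^sup>+ w. indicator {0} (f w) \<partial>PiM K M) = (\<integral>\<^sup>+ w. indicator {w\<in>space (PiM K M). f w = 0} w \<partial>PiM K M)"
      by (intro nn_integral_cong) (auto simp: indicator_def)
    then show ?thesis by simp
  qed
  also have "\<dots> = (\<integral>\<^sup>+ w. indicator {0} (f w) \<partial>PiM (insert k ?R) M)"
    unfolding K' ..
  also have "\<dots> = (\<integral>\<^sup>+ x. (\<integral>\<^sup>+ y. indicator {0} (f (x(k := y))) \<partial>M k) \<partial>PiM ?R M)"
    using K by (intro product_nn_integral_insert) (simp_all add: K' del: insert_Diff_single)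
  also have "\<dots> = (\<integral>\<^sup>+ x. 0 \<partial>PiM ?R M)"
  proof (intro nn_integral_cong)
    fix x
    define a where "a = (\<Sum>i\<in>I - {k}. x i * c i) + x b"
    have "f (x(k := y)) = y * c k + a" for y
      using k K fI by (auto simp: f_def a_def sum.remove[of I k])
    then have "(indicator {0} (f (x(k := y))) :: ennreal) = indicator {- a / c k} y" for y
      using k by (auto simp: indicator_def field_simps)
    then show "(\<integral>\<^sup>+ y. indicator {0} (f (x(k := y))) \<partial>M k) = 0"
      using k by (simp add: emeasure_gauss_singleton)
  qed
  finally have "emeasure (PiM K M) {w\<in>space (PiM K M). f w = 0} = 0" by simp
  then show ?thesis
    unfolding f_def[symmetric] by (intro AE_I[of _ _ "{w\<in>space (PiM K M). f w = 0}"]) auto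
qed

end

definition layer :: "nat \<Rightarrow> nat \<Rightarrow> nat \<Rightarrow> param set" where
  "layer l n N = {Wt l i j | i j. i < N \<and> j < n} \<union> {Bs l i | i. i < N}"

lemma finite_layer: "finite (layer l n N)"
proof -
  have "layer l n N = (\<lambda>(i, j). Wt l i j) ` ({..<N} \<times> {..<n}) \<union> Bs l ` {..<N}"
    by (auto simp: layer_def)
  then show ?thesis by simp
qed

text \<open>Follows from 1 / sqrt (1 - a) <= 1 + a/2 + a^2 and 1 + x <= exp x. The term a/4
  reproduces the mean of the thinned square exactly; a^2/2 is the error that the Chernoff bound has
  to pay for.\<close>

lemma inverse_sqrt_bound:
  assumes "\<bar>a\<bar> \<le> 1 / 2"
  shows "(1 + 1 / sqrt (1 - a)) / 2 \<le> exp (a / 4 + a\<^sup>2 / 2)"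
proof -
  have p: "1 + a / 2 + a\<^sup>2 \<ge> 1 / 2"
    using assms zero_le_power2[of a] by linarith
  have "1 \<le> (1 - a) * (1 + a / 2 + a\<^sup>2)\<^sup>2"
  proof -
    have "a * a\<^sup>2 \<le> 1 / 2 * (1 / 4)"
    proof (cases "a \<ge> 0")
      case True
      then have "a\<^sup>2 \<le> (1 / 2)\<^sup>2" using assms by (intro power_mono) auto
      then show ?thesis using True assms by (intro mult_mono) (auto simp: power2_eq_square)
    next
      case False
      then show ?thesis using mult_nonpos_nonneg[of a "a\<^sup>2"] by simp
    qed
    then have "0 \<le> a\<^sup>2 * (5 / 4 - 5 / 4 * a - a * a\<^sup>2)"
      using assms by (intro mult_nonneg_nonneg) auto
    also have "\<dots> = (1 - a) * (1 + a / 2 + a\<^sup>2)\<^sup>2 - 1"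
      by (simp add: power2_eq_square algebra_simps) (simp add: field_simps)
    finally show ?thesis by simp
  qed
  then have "1 \<le> sqrt ((1 - a) * (1 + a / 2 + a\<^sup>2)\<^sup>2)" by simp
  also have "\<dots> = sqrt (1 - a) * (1 + a / 2 + a\<^sup>2)"
    using p by (simp add: real_sqrt_mult)
  finally have "1 / sqrt (1 - a) \<le> 1 + a / 2 + a\<^sup>2"
    using assms by (simp add: field_simps)
  then have "(1 + 1 / sqrt (1 - a)) / 2 \<le> 1 + (a / 4 + a\<^sup>2 / 2)" by simp
  also have "\<dots> \<le> exp (a / 4 + a\<^sup>2 / 2)" by (rule exp_ge_add_one_self)
  finally show ?thesis .
qed


context symmetric_params
begin

text \<open>Negating all parameters turns the integrand \<open>f\<close> of an active neuron into
  the integrand \<open>g\<close> of an inactive one, so both have the same integral. Wherever the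
  pre-activation is nonzero, one of the two equals 1 and the other exp (l Y^2), whence
  \<open>f\<close> + \<open>g\<close> = 1 + exp (l Y^2) almost everywhere.\<close>

lemma nn_integral_exp_active_square:
  assumes K: "finite K" "I \<subseteq> K" "b \<in> K" "b \<notin> I" and gauss: "\<And>i. i \<in> I \<Longrightarrow> M i = gauss s" and s: "s > 0"
    and x: "\<exists>i\<in>I. x i \<noteq> 0"
    and a: "a = 2 * l * s\<^sup>2 * (\<Sum>i\<in>I. (y i)\<^sup>2)" "\<bar>a\<bar> \<le> 1 / 2"
  shows "(\<integral>\<^sup>+ w. ennreal (exp (l * (if (\<Sum>i\<in>I. w i * x i) + w b > 0 then (\<Sum>i\<in>I. w i * y i)\<^sup>2 else 0))) \<partial>PiM K M)
         \<le> ennreal (exp (a / 4 + a\<^sup>2 / 2))"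
proof (cases "(\<Sum>i\<in>I. (y i)\<^sup>2) = 0")
  case True
  have fI: "finite I" using K finite_subset by blast
  then have "\<forall>i\<in>I. y i = 0" using True by (simp add: sum_nonneg_eq_0_iff)
  then have "(\<Sum>i\<in>I. w i * y i) = 0" for w :: "'i \<Rightarrow> real" by (intro sum.neutral) auto
  then show ?thesis
    using True a prob_space.emeasure_space_1[OF prob_space_P[of K]] by (simp cong: if_cong)
next
  case False
  then have ypos: "(\<Sum>i\<in>I. (y i)\<^sup>2) > 0" by (simp add: sum_nonneg less_le)
  let ?P = "PiM K M"
  define S where "S w = (\<Sum>i\<in>I. w i * x i) + w b" for w :: "'i \<Rightarrow> real"
  define Y where "Y w = (\<Sum>i\<in>I. w i * y i)" for w :: "'i \<Rightarrow> real"
  have meas [measurable]: "S \<in> borel_measurable ?P" "Y \<in> borel_measurable ?P"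
    unfolding S_def Y_def using K by (auto intro!: borel_measurable_add borel_measurable_sum borel_measurable_times)
  define f where "f w = ennreal (exp (l * (if S w > 0 then (Y w)\<^sup>2 else 0)))" for w
  define g where "g w = ennreal (exp (l * (if S w < 0 then (Y w)\<^sup>2 else 0)))" for w
  have fg_meas [measurable]: "f \<in> borel_measurable ?P" "g \<in> borel_measurable ?P"
    unfolding f_def g_def by measurable
  have "integral\<^sup>N ?P f = integral\<^sup>N (distr ?P ?P (\<lambda>w. \<lambda>k\<in>K. - w k)) f"
    using distr_negate[OF K(1)] by simp
  also have "\<dots> = (\<integral>\<^sup>+ w. f (\<lambda>k\<in>K. - w k) \<partial>?P)"
    using K by (intro nn_integral_distr) (auto intro!: measurable_restrict)
  also have "\<dots> = integral\<^sup>N ?P g"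
  proof (intro nn_integral_cong)
    fix w
    have "S (\<lambda>k\<in>K. - w k) = - S w"
      using K unfolding S_def by (simp add: subset_iff flip: sum_negf)
    moreover have "Y (\<lambda>k\<in>K. - w k) = - Y w"
      using K unfolding Y_def by (simp add: subset_iff flip: sum_negf)
    ultimately show "f (\<lambda>k\<in>K. - w k) = g w" by (simp add: f_def g_def)
  qed
  finally have fg: "integral\<^sup>N ?P f = integral\<^sup>N ?P g" .
  have AE: "AE w in ?P. S w \<noteq> 0"
    unfolding S_def using AE_affine_ne_0[OF K] x gauss by blast
  have "2 * integral\<^sup>N ?P f = integral\<^sup>N ?P f + integral\<^sup>N ?P g"
    by (simp add: fg mult_2)
  also have "\<dots> = (\<integral>\<^sup>+ w. f w + g w \<partial>?P)"
    by (rule nn_integral_add[symmetric]) auto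
  also have "\<dots> = (\<integral>\<^sup>+ w. 1 + ennreal (exp (l * (Y w)\<^sup>2)) \<partial>?P)"
    using AE by (intro nn_integral_cong_AE) (auto simp: f_def g_def add.commute elim!: eventually_mono)
  also have "\<dots> = 1 + (\<integral>\<^sup>+ w. ennreal (exp (l * (Y w)\<^sup>2)) \<partial>?P)"
    using prob_space.emeasure_space_1[OF prob_space_P[of K]] by (subst nn_integral_add) auto
  also have "(\<integral>\<^sup>+ w. ennreal (exp (l * (Y w)\<^sup>2)) \<partial>?P) = ennreal (1 / sqrt (1 - a))"
  proof -
    have "distributed ?P lborel Y (normal_density 0 (s * sqrt (\<Sum>i\<in>I. (y i)\<^sup>2)))"
      using distributed_gauss_linear_form[of K M I s y, OF K(1) prob_space_M K(2) gauss s ypos]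
      by (simp add: Y_def[abs_def] mult.commute)
    moreover have "2 * l * (s * sqrt (\<Sum>i\<in>I. (y i)\<^sup>2))\<^sup>2 = a"
      using ypos by (simp add: a power_mult_distrib)
    ultimately show ?thesis
      using s ypos a(2) nn_integral_exp_square_normal[of ?P Y "s * sqrt (\<Sum>i\<in>I. (y i)\<^sup>2)" l] by simp
  qed
  also have "1 + ennreal (1 / sqrt (1 - a)) = 2 * ennreal ((1 + 1 / sqrt (1 - a)) / 2)"
  proof -
    define r where "r = 1 / sqrt (1 - a)"
    have r: "r \<ge> 0" using a(2) by (simp add: r_def)
    have "2 * ennreal ((1 + r) / 2) = ennreal ((1 + r) / 2) + ennreal ((1 + r) / 2)"
      by (rule mult_2)
    also have "\<dots> = ennreal ((1 + r) / 2 + (1 + r) / 2)"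
      using r by (intro ennreal_plus[symmetric]) auto
    also have "(1 + r) / 2 + (1 + r) / 2 = 1 + r"
      by simp
    also have "ennreal (1 + r) = 1 + ennreal r"
      using r by simp
    finally show ?thesis by (simp add: r_def)
  qed
  finally have "integral\<^sup>N ?P f = ennreal ((1 + 1 / sqrt (1 - a)) / 2)"
    by (simp add: ennreal_mult_cancel_left)
  also have "\<dots> \<le> ennreal (exp (a / 4 + a\<^sup>2 / 2))"
    by (intro ennreal_leI inverse_sqrt_bound a)
  finally show ?thesis unfolding f_def[abs_def] S_def Y_def .
qed

end

section \<open>One hidden layer at a fixed input\<close>

locale gaussian_layer = symmetric_params M for M :: "param \<Rightarrow> real measure" +
  fixes l n N :: nat
  assumes N_pos: "N > 0"
    and gauss: "\<And>i j. i < N \<Longrightarrow> j < n \<Longrightarrow> M (Wt l i j) = gauss (sqrt (2 / real N))"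
begin

abbreviation "P \<equiv> PiM (layer l n N) M"

definition row :: "(param \<Rightarrow> real) \<Rightarrow> nat \<Rightarrow> (nat \<Rightarrow> real) \<Rightarrow> real" where
  "row w i y = (\<Sum>j<n. w (Wt l i j) * y j)"

definition preact :: "(param \<Rightarrow> real) \<Rightarrow> (nat \<Rightarrow> real) \<Rightarrow> nat \<Rightarrow> real" where
  "preact w x i = row w i x + w (Bs l i)"

text \<open>This is |D W y|^2, where W is the weight matrix and D the 0/1 diagonal matrix of the
  neurons active at \<open>x\<close>: the squared norm of \<open>y\<close> after the differential of
  the layer.\<close>

definition energy :: "(param \<Rightarrow> real) \<Rightarrow> (nat \<Rightarrow> real) \<Rightarrow> (nat \<Rightarrow> real) \<Rightarrow> real" where
  "energy w x y = (\<Sum>i<N. if preact w x i > 0 then (row w i y)\<^sup>2 else 0)"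

lemma row_measurable [measurable]: "i < N \<Longrightarrow> (\<lambda>w. row w i y) \<in> borel_measurable P"
  unfolding row_def by (auto intro!: borel_measurable_sum borel_measurable_times simp: layer_def)

lemma preact_measurable [measurable]: "i < N \<Longrightarrow> (\<lambda>w. preact w x i) \<in> borel_measurable P"
  unfolding preact_def by (intro borel_measurable_add row_measurable coordinate_measurable) (auto simp: layer_def)

lemma energy_measurable [measurable]: "(\<lambda>w. energy w x y) \<in> borel_measurable P"
  unfolding energy_def by (intro borel_measurable_sum) auto

lemma inj_Wt: "inj_on (Wt l i) A"
  by (auto simp: inj_on_def)

lemma AE_preact_ne_0:
  assumes "\<exists>j<n. x j \<noteq> 0" "i < N"
  shows "AE w in P. preact w x i \<noteq> 0"
proof -
  obtain j where j: "j < n" "x j \<noteq> 0" using assms by blast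
  define x' where "x' k = (case k of Wt _ _ j \<Rightarrow> x j | Bs _ _ \<Rightarrow> 0)" for k
  have "AE w in P. (\<Sum>k\<in>Wt l i ` {..<n}. w k * x' k) + w (Bs l i) \<noteq> 0"
    using assms j gauss[of i j]
    by (intro AE_affine_ne_0[where k = "Wt l i j" and s = "sqrt (2 / real N)"] finite_layer)
      (auto simp: layer_def x'_def)
  then show ?thesis
    by (simp add: preact_def row_def sum.reindex[OF inj_Wt] x'_def)
qed

text \<open>The i-th summand reads only \<open>Bs l i\<close> and the weights
  \<open>Wt l i j\<close>, so the summands are independent and the exponential moment factorises
  over neurons.\<close>

lemma nn_integral_exp_energy:
  assumes x: "\<exists>j<n. x j \<noteq> 0" and t: "8 * \<bar>t\<bar> * ip n y y \<le> real N"
  shows "(\<integral>\<^sup>+ w. ennreal (exp (t * energy w x y)) \<partial>P) \<le> ennreal (exp (t * ip n y y + 8 * t\<^sup>2 * (ip n y y)\<^sup>2 / N))"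
proof -
  interpret prob_space P by (rule prob_space_P)
  \<comment> \<open>Twice \<open>t\<close> times the variance 2 |y|^2 / N of a row applied to
    \<open>y\<close>. The hypothesis on \<open>t\<close> says |a| <= 1/2, and N copies of a/4 add up
    to t |y|^2.\<close>
  define a where "a = 4 * t * ip n y y / N"
  define X where "X i w = ennreal (exp (t * (if preact w x i > 0 then (row w i y)\<^sup>2 else 0)))" for i w
  have X_le: "(\<integral>\<^sup>+ w. X i w \<partial>P) \<le> ennreal (exp (a / 4 + a\<^sup>2 / 2))" if i: "i < N" for i
  proof -
    define x' where "x' k = (case k of Wt _ _ j \<Rightarrow> x j | Bs _ _ \<Rightarrow> 0)" for k
    define y' where "y' k = (case k of Wt _ _ j \<Rightarrow> y j | Bs _ _ \<Rightarrow> 0)" for k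
    have sum: "(\<Sum>k\<in>Wt l i ` {..<n}. f k) = (\<Sum>j<n. f (Wt l i j))" for f :: "param \<Rightarrow> real"
      by (simp add: sum.reindex[OF inj_Wt])
    have "(\<integral>\<^sup>+ w. ennreal (exp (t * (if (\<Sum>k\<in>Wt l i ` {..<n}. w k * x' k) + w (Bs l i) > 0
              then (\<Sum>k\<in>Wt l i ` {..<n}. w k * y' k)\<^sup>2 else 0))) \<partial>P) \<le> ennreal (exp (a / 4 + a\<^sup>2 / 2))"
    proof (rule nn_integral_exp_active_square[where s = "sqrt (2 / real N)"])
      show "a = 2 * t * (sqrt (2 / real N))\<^sup>2 * (\<Sum>k\<in>Wt l i ` {..<n}. (y' k)\<^sup>2)"
        unfolding sum by (simp add: a_def y'_def ip_def power2_eq_square)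
      show "\<bar>a\<bar> \<le> 1 / 2"
        using t N_pos by (simp add: a_def abs_mult field_simps)
      show "\<exists>k\<in>Wt l i ` {..<n}. x' k \<noteq> 0" using x by (auto simp: x'_def)
      show "finite (layer l n N)" by (rule finite_layer)
    qed (use i N_pos gauss in \<open>auto simp: layer_def\<close>)
    then show ?thesis
      unfolding sum X_def preact_def row_def x'_def y'_def param.case .
  qed
  have "indep_vars M (\<lambda>k w. w k) (layer l n N)"
    by (intro indep_vars_PiM_coordinates finite_layer prob_space_M)
  then have "indep_vars (\<lambda>i. PiM (layer l n N \<inter> (insert (Bs l i) (Wt l i ` {..<n}))) M)
     (\<lambda>i w. restrict (\<lambda>k. w k) (layer l n N \<inter> (insert (Bs l i) (Wt l i ` {..<n})))) {..<N}"
    by (rule indep_vars_restrict) (auto simp: disjoint_family_on_def)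
  then have "indep_vars (\<lambda>_. borel) (\<lambda>i w. X i (restrict (\<lambda>k. w k) (layer l n N \<inter> (insert (Bs l i) (Wt l i ` {..<n}))))) {..<N}"
  proof (rule indep_vars_compose2)
    fix i assume i: "i \<in> {..<N}"
    let ?R = "layer l n N \<inter> (insert (Bs l i) (Wt l i ` {..<n}))"
    have row_R [measurable]: "(\<lambda>w. row w i y) \<in> borel_measurable (PiM ?R M)" for y
      unfolding row_def using i by (auto intro!: borel_measurable_sum borel_measurable_times simp: layer_def)
    have [measurable]: "(\<lambda>w. preact w x i) \<in> borel_measurable (PiM ?R M)"
      unfolding preact_def using i by (intro borel_measurable_add row_R coordinate_measurable) (auto simp: layer_def)
    show "X i \<in> borel_measurable (PiM ?R M)"
      unfolding X_def by measurable
  qed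
  moreover have "X i (restrict (\<lambda>k. w k) (layer l n N \<inter> (insert (Bs l i) (Wt l i ` {..<n})))) = X i w" if "i < N" for i w
    using that by (simp add: X_def preact_def row_def layer_def)
  ultimately have indep: "indep_vars (\<lambda>_. borel) X {..<N}"
    by (subst (asm) indep_vars_cong[where Y = X and J = "{..<N}" and N' = "\<lambda>_. borel"]) auto
  have "(\<integral>\<^sup>+ w. ennreal (exp (t * energy w x y)) \<partial>P) = (\<integral>\<^sup>+ w. (\<Prod>i<N. X i w) \<partial>P)"
    by (intro nn_integral_cong) (simp add: energy_def X_def sum_distrib_left exp_sum prod_ennreal)
  also have "\<dots> = (\<Prod>i<N. \<integral>\<^sup>+ w. X i w \<partial>P)"
    by (intro indep_vars_nn_integral indep) auto
  also have "\<dots> \<le> (\<Prod>i<N. ennreal (exp (a / 4 + a\<^sup>2 / 2)))"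
    by (intro prod_mono_ennreal) (simp add: X_le)
  also have "\<dots> = ennreal (exp (real N * (a / 4 + a\<^sup>2 / 2)))"
    by (simp add: ennreal_power exp_of_nat_mult)
  also have "real N * (a / 4 + a\<^sup>2 / 2) = t * ip n y y + 8 * t\<^sup>2 * (ip n y y)\<^sup>2 / N"
    using N_pos by (simp add: a_def field_simps power2_eq_square)
  finally show ?thesis .
qed

text \<open>Two Chernoff bounds. The restriction to squared norm 2 accommodates the grid points,
  which reach 25/16.\<close>

lemma energy_tail:
  assumes x: "\<exists>j<n. x j \<noteq> 0" and y: "ip n y y \<le> 2" and r: "0 < r" "r \<le> 4"
  shows "emeasure P {w\<in>space P. \<bar>energy w x y - ip n y y\<bar> \<ge> r} \<le> ennreal (2 * exp (- real N * r\<^sup>2 / 128))"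
proof -
  \<comment> \<open>The minimiser of - t r + 32 t^2 / N, the exponent left after (ip n y y)^2 <= 4.
    The condition r <= 4 keeps this \<open>t\<close> in the admissible range.\<close>
  define t where "t = real N * r / 64"
  have t: "t > 0" using N_pos r by (simp add: t_def)
  have tb: "8 * \<bar>t\<bar> * ip n y y \<le> real N"
  proof -
    have "8 * \<bar>t\<bar> * ip n y y \<le> 8 * t * 2" using t y by (simp add: abs_of_pos)
    also have "\<dots> = real N * (r / 4)" by (simp add: t_def)
    also have "\<dots> \<le> real N" using r N_pos by simp
    finally show ?thesis .
  qed
  have key: "- t * r + 8 * t\<^sup>2 * (ip n y y)\<^sup>2 / N \<le> - real N * r\<^sup>2 / 128"
  proof -
    have "(ip n y y)\<^sup>2 \<le> 2\<^sup>2" using y by (intro power_mono) auto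
    then have "8 * t\<^sup>2 * (ip n y y)\<^sup>2 / N \<le> 8 * t\<^sup>2 * 4 / N"
      by (intro divide_right_mono mult_left_mono) auto
    also have "- t * r + 8 * t\<^sup>2 * 4 / N = - real N * r\<^sup>2 / 128"
      using N_pos by (simp add: t_def field_simps power2_eq_square)
    finally show ?thesis by linarith
  qed
  have up: "emeasure P {w\<in>space P. energy w x y - ip n y y \<ge> r} \<le> ennreal (exp (- real N * r\<^sup>2 / 128))"
  proof -
    have "emeasure P {w\<in>space P. energy w x y \<ge> ip n y y + r}
      \<le> ennreal (exp (- t * (ip n y y + r))) * (\<integral>\<^sup>+w. ennreal (exp (t * energy w x y)) * indicator (space P) w \<partial>P)"
      by (rule Chernoff_ineq_nn_integral_ge) (use t in auto)
    also have "(\<integral>\<^sup>+w. ennreal (exp (t * energy w x y)) * indicator (space P) w \<partial>P) = (\<integral>\<^sup>+w. ennreal (exp (t * energy w x y)) \<partial>P)"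
      by (intro nn_integral_cong) auto
    also have "\<dots> \<le> ennreal (exp (t * ip n y y + 8 * t\<^sup>2 * (ip n y y)\<^sup>2 / N))"
      by (intro nn_integral_exp_energy[OF x] tb)
    also have "ennreal (exp (- t * (ip n y y + r))) * \<dots> = ennreal (exp (- t * r + 8 * t\<^sup>2 * (ip n y y)\<^sup>2 / N))"
      by (simp add: ennreal_mult[symmetric] mult_exp_exp algebra_simps)
    also have "\<dots> \<le> ennreal (exp (- real N * r\<^sup>2 / 128))"
      using key by (intro ennreal_leI) simp
    finally show ?thesis by (simp add: le_diff_eq add.commute mult_left_mono)
  qed
  have lo: "emeasure P {w\<in>space P. energy w x y - ip n y y \<le> - r} \<le> ennreal (exp (- real N * r\<^sup>2 / 128))"
  proof -
    have "emeasure P {w\<in>space P. energy w x y \<le> ip n y y - r}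
      \<le> ennreal (exp (t * (ip n y y - r))) * (\<integral>\<^sup>+w. ennreal (exp (- t * energy w x y)) * indicator (space P) w \<partial>P)"
      by (rule Chernoff_ineq_nn_integral_le) (use t in auto)
    also have "(\<integral>\<^sup>+w. ennreal (exp (- t * energy w x y)) * indicator (space P) w \<partial>P) = (\<integral>\<^sup>+w. ennreal (exp (- t * energy w x y)) \<partial>P)"
      by (intro nn_integral_cong) auto
    also have "\<dots> \<le> ennreal (exp (- t * ip n y y + 8 * (- t)\<^sup>2 * (ip n y y)\<^sup>2 / N))"
      using tb by (intro nn_integral_exp_energy[OF x]) simp
    also have "ennreal (exp (t * (ip n y y - r))) * \<dots> = ennreal (exp (- t * r + 8 * t\<^sup>2 * (ip n y y)\<^sup>2 / N))"
      by (simp add: ennreal_mult[symmetric] mult_exp_exp algebra_simps)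
    also have "\<dots> \<le> ennreal (exp (- real N * r\<^sup>2 / 128))"
      using key by (intro ennreal_leI) simp
    finally show ?thesis by (simp add: diff_le_eq add.commute mult_left_mono)
  qed
  have "emeasure P {w\<in>space P. \<bar>energy w x y - ip n y y\<bar> \<ge> r}
    \<le> emeasure P ({w\<in>space P. energy w x y - ip n y y \<ge> r} \<union> {w\<in>space P. energy w x y - ip n y y \<le> - r})"
    by (intro emeasure_mono) auto
  also have "\<dots> \<le> emeasure P {w\<in>space P. energy w x y - ip n y y \<ge> r} + emeasure P {w\<in>space P. energy w x y - ip n y y \<le> - r}"
    by (intro emeasure_subadditive) auto
  also have "\<dots> \<le> ennreal (exp (- real N * r\<^sup>2 / 128)) + ennreal (exp (- real N * r\<^sup>2 / 128))"
    by (intro add_mono up lo)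
  also have "\<dots> = ennreal (2 * exp (- real N * r\<^sup>2 / 128))"
    by (simp flip: ennreal_plus)
  finally show ?thesis .
qed

lemma row_cong: "(\<And>j. j < n \<Longrightarrow> y j = y' j) \<Longrightarrow> row w i y = row w i y'"
  by (simp add: row_def)

lemma row_lincomb: "row w i (\<lambda>j. \<Sum>k<d. c k * e k j) = (\<Sum>k<d. c k * row w i (e k))"
  using ip_sum_right[of n "\<lambda>j. w (Wt l i j)" c e "{..<d}"] by (simp add: row_def ip_def)

lemma energy_lincomb:
  "energy w x (\<lambda>j. \<Sum>k<d. c k * e k j)
    = (\<Sum>k<d. \<Sum>m<d. (\<Sum>i<N. if preact w x i > 0 then row w i (e k) * row w i (e m) else 0) * c k * c m)"
proof -
  have "energy w x (\<lambda>j. \<Sum>k<d. c k * e k j)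
     = (\<Sum>i<N. \<Sum>k<d. \<Sum>m<d. (if preact w x i > 0 then row w i (e k) * row w i (e m) else 0) * c k * c m)"
    unfolding energy_def row_lincomb power2_eq_square sum_product
    by (intro sum.cong refl) (auto simp: mult_ac)
  also have "\<dots> = (\<Sum>k<d. \<Sum>i<N. \<Sum>m<d. (if preact w x i > 0 then row w i (e k) * row w i (e m) else 0) * c k * c m)"
    by (rule sum.swap)
  also have "\<dots> = (\<Sum>k<d. \<Sum>m<d. \<Sum>i<N. (if preact w x i > 0 then row w i (e k) * row w i (e m) else 0) * c k * c m)"
    by (intro sum.cong refl sum.swap)
  finally show ?thesis by (simp add: sum_distrib_right)
qed

text \<open>The vectors \<open>a k\<close> are fixed while the layer is random. In coordinates with
  respect to an orthonormalisation of the \<open>a k\<close>, the deviation energy - |y|^2 is a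
  quadratic form in \<open>d\<close> variables, so it suffices to control it at the grid points. The
  event \<open>B\<close> therefore serves all combinations of the \<open>a k\<close> at once and
  costs a factor 96^d whatever the dimension \<open>n\<close>.\<close>

lemma layer_near_isometry:
  fixes a :: "nat \<Rightarrow> nat \<Rightarrow> real"
  assumes x: "\<exists>j<n. x j \<noteq> 0" and r: "0 < r" "r \<le> 4"
  obtains B where "B \<in> sets P"
    "measure P B \<ge> 1 - 96 ^ d * (2 * exp (- real N * r\<^sup>2 / 128))"
    "\<And>w i. w \<in> B \<Longrightarrow> i < N \<Longrightarrow> preact w x i \<noteq> 0"
    "\<And>w c. w \<in> B \<Longrightarrow> \<bar>energy w x (\<lambda>j. \<Sum>k<d. c k * a k j) - ip n (\<lambda>j. \<Sum>k<d. c k * a k j) (\<lambda>j. \<Sum>k<d. c k * a k j)\<bar>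
       \<le> 16 / 7 * r * ip n (\<lambda>j. \<Sum>k<d. c k * a k j) (\<lambda>j. \<Sum>k<d. c k * a k j)"
proof -
  interpret prob_space P by (rule prob_space_P)
  obtain e where e: "\<forall>k<d. \<forall>l<d. k \<noteq> l \<longrightarrow> ip n (e k) (e l) = 0"
      "\<forall>k<d. ip n (e k) (e k) = 0 \<or> ip n (e k) (e k) = 1"
      "\<forall>k<d. \<forall>j<n. a k j = (\<Sum>m<d. ip n (a k) (e m) * e m j)"
    using gram_schmidt[of d n a] by (elim exE conjE)
  have orth: "ip n (e k) (e l) = 0" if "k < d" "l < d" "k \<noteq> l" for k l
    using e(1) that by simp
  have nrm: "ip n (e k) (e k) = 0 \<or> ip n (e k) (e k) = 1" if "k < d" for k
    using e(2) that by simp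
  have span: "a k j = (\<Sum>m<d. ip n (a k) (e m) * e m j)" if "k < d" "j < n" for k j
    using e(3) that by blast
  define v where "v c = (\<lambda>j. \<Sum>m<d. c m * e m j)" for c :: "nat \<Rightarrow> real"
  define gp where "gp z = v (\<lambda>k. real_of_int (z k) / (4 * sqrt (real d)))" for z :: "nat \<Rightarrow> int"
  define dev where "dev w y = energy w x y - ip n y y" for w y
  have dev_meas [measurable]: "(\<lambda>w. dev w y) \<in> borel_measurable P" for y
    unfolding dev_def by measurable
  define B where "B = {w\<in>space P. (\<forall>i\<in>{..<N}. preact w x i \<noteq> 0) \<and> (\<forall>z\<in>grid d. \<not> \<bar>dev w (gp z)\<bar> \<ge> r)}"
  have B_sets: "B \<in> sets P"
    unfolding B_def by (intro sets.sets_Collect_conj sets.sets_Collect_finite_All) (auto simp: finite_grid)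
  \<comment> \<open>In general only an inequality: coordinates along a vanishing \<open>e k\<close>
    are lost.\<close>
  have ip_v: "ip n (v c) (v c) \<le> ip d c c" for c
  proof -
    have "ip n (v c) (v c) = (\<Sum>k<d. c k * (\<Sum>m<d. c m * ip n (e k) (e m)))"
      unfolding v_def ip_sum_left ip_sum_right ..
    also have "\<dots> \<le> (\<Sum>k<d. c k * c k)"
    proof (rule sum_mono)
      fix k assume k: "k \<in> {..<d}"
      have "(\<Sum>m<d. c m * ip n (e k) (e m)) = (\<Sum>m<d. if m = k then c k * ip n (e k) (e k) else 0)"
        using k by (intro sum.cong refl) (auto intro: orth)
      also have "\<dots> = c k * ip n (e k) (e k)" using k by simp
      finally show "c k * (\<Sum>m<d. c m * ip n (e k) (e m)) \<le> c k * c k"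
        using nrm[of k] k by auto
    qed
    finally show ?thesis by (simp add: ip_def)
  qed
  have gp_le: "ip n (gp z) (gp z) \<le> 2" if "z \<in> grid d" for z
  proof -
    have "ip n (gp z) (gp z) \<le> ip d (\<lambda>k. real_of_int (z k) / (4 * sqrt d)) (\<lambda>k. real_of_int (z k) / (4 * sqrt d))"
      unfolding gp_def by (rule ip_v)
    also have "\<dots> = (\<Sum>k<d. (real_of_int (z k))\<^sup>2) / (16 * d)"
      by (simp add: ip_def power2_eq_square sum_divide_distrib)
    also have "\<dots> \<le> 2" using that by (cases "d = 0") (auto simp: grid_def field_simps)
    finally show ?thesis .
  qed
  have "AE w in P. \<forall>i\<in>{..<N}. preact w x i \<noteq> 0"
    by (intro AE_finite_allI) (auto intro: AE_preact_ne_0[OF x])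
  then have null: "emeasure P {w\<in>space P. \<not> (\<forall>i\<in>{..<N}. preact w x i \<noteq> 0)} = 0"
    by (subst (asm) AE_iff_measurable[OF _ refl]) auto
  have "emeasure P (space P - B)
     \<le> emeasure P ({w\<in>space P. \<not> (\<forall>i\<in>{..<N}. preact w x i \<noteq> 0)} \<union> (\<Union>z\<in>grid d. {w\<in>space P. \<bar>dev w (gp z)\<bar> \<ge> r}))"
    by (intro emeasure_mono sets.Un sets.finite_UN finite_grid) (auto simp: B_def)
  also have "\<dots> \<le> emeasure P {w\<in>space P. \<not> (\<forall>i\<in>{..<N}. preact w x i \<noteq> 0)}
       + emeasure P (\<Union>z\<in>grid d. {w\<in>space P. \<bar>dev w (gp z)\<bar> \<ge> r})"
    by (intro emeasure_subadditive sets.finite_UN finite_grid) auto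
  also have "\<dots> \<le> 0 + (\<Sum>z\<in>grid d. emeasure P {w\<in>space P. \<bar>dev w (gp z)\<bar> \<ge> r})"
    unfolding null by (intro add_mono emeasure_subadditive_finite finite_grid) auto
  also have "\<dots> \<le> 0 + (\<Sum>z\<in>grid d. ennreal (2 * exp (- real N * r\<^sup>2 / 128)))"
    unfolding dev_def by (intro add_mono sum_mono energy_tail[OF x] gp_le r) auto
  also have "\<dots> = ennreal (real (card (grid d)) * (2 * exp (- real N * r\<^sup>2 / 128)))"
    by (simp add: ennreal_of_nat_eq_real_of_nat ennreal_mult)
  also have "\<dots> \<le> ennreal (96 ^ d * (2 * exp (- real N * r\<^sup>2 / 128)))"
    by (intro ennreal_leI mult_right_mono card_grid) auto
  finally have "measure P (space P - B) \<le> 96 ^ d * (2 * exp (- real N * r\<^sup>2 / 128))"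
    by (simp add: emeasure_eq_measure)
  then have B_prob: "measure P B \<ge> 1 - 96 ^ d * (2 * exp (- real N * r\<^sup>2 / 128))"
    using prob_compl[OF B_sets] by simp
  show thesis
  proof (rule that[OF B_sets B_prob])
    fix w i assume "w \<in> B" "i < N"
    then show "preact w x i \<noteq> 0" by (auto simp: B_def)
  next
    fix w and c :: "nat \<Rightarrow> real" assume w: "w \<in> B"
    define y where "y = (\<lambda>j. \<Sum>k<d. c k * a k j)"
    \<comment> \<open>The coefficients \<open>c\<close> over the \<open>a k\<close> carry no norm
      information. The coordinates with respect to \<open>e\<close> describe the same vector and
      satisfy |c'| = |y| exactly, even when some \<open>e m\<close> vanish.\<close>
    define c' where "c' m = ip n y (e m)" for m
    have y_v: "y j = v c' j" if "j < n" for j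
    proof -
      have "y j = (\<Sum>k<d. c k * (\<Sum>m<d. ip n (a k) (e m) * e m j))"
        unfolding y_def by (intro sum.cong refl) (subst span[OF _ that], auto)
      also have "\<dots> = (\<Sum>k<d. \<Sum>m<d. c k * ip n (a k) (e m) * e m j)"
        by (simp add: sum_distrib_left mult.assoc)
      also have "\<dots> = (\<Sum>m<d. \<Sum>k<d. c k * ip n (a k) (e m) * e m j)"
        by (rule sum.swap)
      also have "\<dots> = v c' j"
        unfolding v_def c'_def y_def ip_sum_left by (simp add: sum_distrib_right)
      finally show ?thesis .
    qed
    have ip_y: "ip n z y = ip n z (v c')" "ip n y z = ip n (v c') z" for z
      using y_v by (simp_all add: ip_def)
    have "energy w x y = energy w x (v c')"
      unfolding energy_def using row_cong[of y "v c'" w, OF y_v] by (simp cong: if_cong)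
    then have dev_y: "dev w y = dev w (v c')"
      by (simp add: dev_def ip_y)
    have c'c': "ip d c' c' = ip n y y"
    proof -
      have "ip n y y = ip n y (v c')" by (rule ip_y)
      also have "\<dots> = ip d c' c'" unfolding v_def ip_sum_right by (simp add: ip_def[of d] c'_def)
      finally show ?thesis by simp
    qed
    define Q where "Q k m = (\<Sum>i<N. if preact w x i > 0 then row w i (e k) * row w i (e m) else 0) - ip n (e k) (e m)" for k m
    have dev_Q: "dev w (v c) = (\<Sum>k<d. \<Sum>m<d. Q k m * c k * c m)" for c
    proof -
      have "ip n (v c) (v c) = (\<Sum>k<d. \<Sum>m<d. ip n (e k) (e m) * c k * c m)"
        unfolding v_def ip_sum_left ip_sum_right by (simp add: sum_distrib_left mult_ac)
      moreover have "energy w x (v c) = (\<Sum>k<d. \<Sum>m<d. (\<Sum>i<N. if preact w x i > 0 then row w i (e k) * row w i (e m) else 0) * c k * c m)"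
        unfolding v_def by (rule energy_lincomb)
      ultimately show ?thesis
        by (simp add: dev_def Q_def left_diff_distrib sum_subtractf)
    qed
    have "\<bar>\<Sum>k<d. \<Sum>m<d. Q k m * c' k * c' m\<bar> \<le> 16 / 7 * r * ip d c' c'"
    proof (rule quadratic_form_bound_from_grid)
      show "Q k m = Q m k" for k m
        unfolding Q_def by (simp add: mult.commute ip_commute cong: if_cong)
      fix z assume "z \<in> grid d"
      then have "\<bar>dev w (gp z)\<bar> \<le> r" using w by (fastforce simp: B_def)
      then show "\<bar>\<Sum>k<d. \<Sum>m<d. Q k m * (real_of_int (z k) / (4 * sqrt (real d))) * (real_of_int (z m) / (4 * sqrt (real d)))\<bar> \<le> r"
        unfolding gp_def dev_Q .
    qed
    then have "\<bar>dev w y\<bar> \<le> 16 / 7 * r * ip n y y"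
      unfolding dev_y dev_Q c'c' .
    then show "\<bar>energy w x (\<lambda>j. \<Sum>k<d. c k * a k j) - ip n (\<lambda>j. \<Sum>k<d. c k * a k j) (\<lambda>j. \<Sum>k<d. c k * a k j)\<bar>
       \<le> 16 / 7 * r * ip n (\<lambda>j. \<Sum>k<d. c k * a k j) (\<lambda>j. \<Sum>k<d. c k * a k j)"
      unfolding dev_def y_def .
  qed
qed

end

section \<open>The output layer\<close>

context symmetric_params
begin

lemma expectation_cos_linear_form:
  assumes K: "finite K" "I \<subseteq> K" and gauss: "\<And>i. i \<in> I \<Longrightarrow> M i = gauss 1"
  shows "(\<integral>w. cos (\<Sum>i\<in>I. c i * w i) \<partial>PiM K M) = exp (- (\<Sum>i\<in>I. (c i)\<^sup>2) / 2)"
proof (cases "(\<Sum>i\<in>I. (c i)\<^sup>2) = 0")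
  case True
  interpret prob_space "PiM K M" by (rule prob_space_P)
  have "finite I" using K finite_subset by blast
  then have "\<forall>i\<in>I. c i = 0" using True by (simp add: sum_nonneg_eq_0_iff)
  then show ?thesis using True prob_space by simp
next
  case False
  then have pos: "(\<Sum>i\<in>I. (c i)\<^sup>2) > 0" by (simp add: sum_nonneg less_le)
  show ?thesis
    using expectation_cos_normal[OF distributed_gauss_linear_form[of K M I 1 c, OF K(1) prob_space_M K(2) gauss _ pos]] pos
    by simp
qed

end

lemma nn_integral_exp_square_gauss:
  assumes "2 * l < 1"
  shows "(\<integral>\<^sup>+ x. ennreal (exp (l * x\<^sup>2)) \<partial>gauss 1) = ennreal (1 / sqrt (1 - 2 * l))"
proof -
  have "distr (gauss 1) lborel (\<lambda>x. x) = gauss 1"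
    by (rule distr_id2) simp
  then have "distributed (gauss 1) lborel (\<lambda>x. x) (normal_density 0 1)"
    by (auto simp: distributed_def gauss_def)
  from nn_integral_exp_square_normal[OF this, of l] show ?thesis using assms by simp
qed

context symmetric_params
begin

text \<open>Linearising the Gaussian as the characteristic function of an auxiliary Gaussian vector \<open>h\<close>
  turns \<open>A\<^sup>T g\<close> into \<open>A h\<close>, for which the lower bound on \<open>A\<close> applies pointwise.\<close>
lemma nn_integral_exp_adjoint:
  fixes a :: "nat \<Rightarrow> nat \<Rightarrow> real" and wt :: "nat \<Rightarrow> 'i"
  assumes K: "finite K" "wt ` {..<n} \<subseteq> K" "inj_on wt {..<n}" and gauss: "\<And>j. j < n \<Longrightarrow> M (wt j) = gauss 1"
    and A: "\<And>v. \<sigma>2 * ip d v v \<le> ip n (\<lambda>j. \<Sum>k<d. v k * a k j) (\<lambda>j. \<Sum>k<d. v k * a k j)"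
    and \<mu>: "\<mu> > 0" and \<sigma>2: "\<sigma>2 > 0"
  shows "(\<integral>\<^sup>+ w. ennreal (exp (- (\<mu> / 2) * (\<Sum>k<d. (\<Sum>j<n. w (wt j) * a k j)\<^sup>2))) \<partial>PiM K M)
     \<le> ennreal ((1 / sqrt (1 + \<mu> * \<sigma>2)) ^ d)"
proof -
  let ?P = "PiM K M"
  let ?H = "PiM {..<d} (\<lambda>_. gauss 1)"
  interpret P: prob_space ?P by (rule prob_space_P)
  interpret H: symmetric_params "\<lambda>_::nat. gauss 1"
  proof (intro symmetric_params.intro product_sigma_finite.intro symmetric_params_axioms.intro)
    show "sigma_finite_measure (gauss 1)"
      by (intro prob_space_imp_sigma_finite prob_space_gauss) simp
    show "symmetric_dist (gauss 1)" by (rule symmetric_dist_gauss) simp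
  qed
  interpret Hp: prob_space ?H by (rule H.prob_space_P)
  interpret PH: pair_prob_space ?P ?H ..
  have [measurable]: "(\<lambda>w. w (wt j)) \<in> borel_measurable ?P" if "j < n" for j
    using K that by auto
  \<comment> \<open>The real part of the characteristic function is enough, since the sine
    integrates to zero. The integrand is then bounded by 1, which gives the integrability needed to
    swap the two expectations.\<close>
  define F where "F w h = cos (sqrt \<mu> * (\<Sum>k<d. h k * (\<Sum>j<n. w (wt j) * a k j)))" for w :: "'i \<Rightarrow> real" and h :: "nat \<Rightarrow> real"
  have inner_meas: "(\<lambda>w. \<Sum>j<n. w (wt j) * a k j) \<in> borel_measurable ?P" for k
    by (intro borel_measurable_sum borel_measurable_times) auto
  have F_meas: "case_prod F \<in> borel_measurable (?P \<Otimes>\<^sub>M ?H)"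
    unfolding F_def split_beta'
    by (intro measurable_compose[OF _ borel_measurable_continuous_onI[OF continuous_on_cos[OF continuous_on_id]]]
        borel_measurable_times borel_measurable_sum borel_measurable_const
        measurable_compose[OF measurable_fst inner_meas] measurable_compose[OF measurable_snd H.coordinate_measurable]) auto
  have F_int: "integrable (?P \<Otimes>\<^sub>M ?H) (case_prod F)"
    by (rule PH.P.integrable_const_bound[where B = 1]) (use F_meas in \<open>auto simp: F_def split_beta'\<close>)
  have lin: "exp (- (\<mu> / 2) * (\<Sum>k<d. (\<Sum>j<n. w (wt j) * a k j)\<^sup>2)) = (\<integral>h. F w h \<partial>?H)" for w :: "'i \<Rightarrow> real"
  proof -
    have "(\<integral>h. F w h \<partial>?H) = (\<integral>h. cos (\<Sum>k<d. sqrt \<mu> * (\<Sum>j<n. w (wt j) * a k j) * h k) \<partial>?H)"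
    proof -
      have "sqrt \<mu> * (\<Sum>k<d. h k * z k) = (\<Sum>k<d. sqrt \<mu> * z k * h k)" for h z :: "nat \<Rightarrow> real"
        by (simp add: sum_distrib_left mult_ac)
      then show ?thesis unfolding F_def by simp
    qed
    also have "\<dots> = exp (- (\<Sum>k<d. (sqrt \<mu> * (\<Sum>j<n. w (wt j) * a k j))\<^sup>2) / 2)"
      by (rule H.expectation_cos_linear_form) auto
    also have "(\<Sum>k<d. (sqrt \<mu> * (\<Sum>j<n. w (wt j) * a k j))\<^sup>2) = \<mu> * (\<Sum>k<d. (\<Sum>j<n. w (wt j) * a k j)\<^sup>2)"
      using \<mu> by (simp add: power_mult_distrib flip: sum_distrib_left)
    finally show ?thesis by simp
  qed
  have dual: "(\<integral>w. F w h \<partial>?P) = exp (- (\<mu> / 2) * ip n (\<lambda>j. \<Sum>k<d. h k * a k j) (\<lambda>j. \<Sum>k<d. h k * a k j))" for h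
  proof -
    \<comment> \<open>The Gaussian lemma sums over parameters rather than neuron indices, so the
      coefficients are transported through the inverse of \<open>wt\<close>.\<close>
    define c where "c i = sqrt \<mu> * (\<Sum>k<d. h k * a k (the_inv_into {..<n} wt i))" for i
    have c: "c (wt j) = sqrt \<mu> * (\<Sum>k<d. h k * a k j)" if "j < n" for j
      using that K by (simp add: c_def the_inv_into_f_f)
    have "sqrt \<mu> * (\<Sum>k<d. h k * (\<Sum>j<n. w (wt j) * a k j)) = (\<Sum>i\<in>wt ` {..<n}. c i * w i)" for w
    proof -
      have "(\<Sum>i\<in>wt ` {..<n}. c i * w i) = (\<Sum>j<n. c (wt j) * w (wt j))"
        by (rule sum.reindex_cong[OF K(3)]) auto
      also have "\<dots> = (\<Sum>j<n. \<Sum>k<d. sqrt \<mu> * (h k * (w (wt j) * a k j)))"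
        by (rule sum.cong) (simp_all add: c sum_distrib_left sum_distrib_right mult_ac)
      also have "\<dots> = (\<Sum>k<d. \<Sum>j<n. sqrt \<mu> * (h k * (w (wt j) * a k j)))"
        by (rule sum.swap)
      finally show ?thesis by (simp add: sum_distrib_left)
    qed
    then have "(\<integral>w. F w h \<partial>?P) = (\<integral>w. cos (\<Sum>i\<in>wt ` {..<n}. c i * w i) \<partial>?P)"
      by (simp add: F_def)
    also have "\<dots> = exp (- (\<Sum>i\<in>wt ` {..<n}. (c i)\<^sup>2) / 2)"
      using K gauss by (intro expectation_cos_linear_form) auto
    also have "(\<Sum>i\<in>wt ` {..<n}. (c i)\<^sup>2) = (\<Sum>j<n. (c (wt j))\<^sup>2)"
      by (rule sum.reindex_cong[OF K(3)]) auto
    also have "\<dots> = \<mu> * ip n (\<lambda>j. \<Sum>k<d. h k * a k j) (\<lambda>j. \<Sum>k<d. h k * a k j)"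
      using \<mu> by (simp add: c ip_def power_mult_distrib power2_eq_square[symmetric] flip: sum_distrib_left)
    finally show ?thesis by simp
  qed
  have "(\<integral>\<^sup>+ w. ennreal (exp (- (\<mu> / 2) * (\<Sum>k<d. (\<Sum>j<n. w (wt j) * a k j)\<^sup>2))) \<partial>?P)
     = (\<integral>\<^sup>+ w. ennreal (\<integral>h. F w h \<partial>?H) \<partial>?P)" by (simp only: lin)
  also have "\<dots> = ennreal (\<integral>w. (\<integral>h. F w h \<partial>?H) \<partial>?P)"
    by (intro nn_integral_eq_integral PH.integrable_fst[OF F_int]) (auto simp flip: lin)
  also have "(\<integral>w. (\<integral>h. F w h \<partial>?H) \<partial>?P) = (\<integral>h. (\<integral>w. F w h \<partial>?P) \<partial>?H)"
    by (rule PH.Fubini_integral[OF F_int, symmetric])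
  also have "ennreal \<dots> = (\<integral>\<^sup>+ h. ennreal (\<integral>w. F w h \<partial>?P) \<partial>?H)"
    by (intro nn_integral_eq_integral[symmetric] PH.integrable_snd[OF F_int]) (auto simp: dual)
  also have "\<dots> \<le> (\<integral>\<^sup>+ h. (\<Prod>k<d. ennreal (exp (- (\<mu> * \<sigma>2 / 2) * (h k)\<^sup>2))) \<partial>?H)"
  proof (intro nn_integral_mono)
    fix h :: "nat \<Rightarrow> real"
    have "exp (- (\<mu> / 2) * ip n (\<lambda>j. \<Sum>k<d. h k * a k j) (\<lambda>j. \<Sum>k<d. h k * a k j)) \<le> exp (- (\<mu> / 2) * (\<sigma>2 * ip d h h))"
      using A[of h] \<mu> by simp
    also have "- (\<mu> / 2) * (\<sigma>2 * ip d h h) = (\<Sum>k<d. - (\<mu> * \<sigma>2 / 2) * (h k)\<^sup>2)"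
      by (simp add: ip_def sum_distrib_left power2_eq_square sum_negf mult_ac)
    also have "exp \<dots> = (\<Prod>k<d. exp (- (\<mu> * \<sigma>2 / 2) * (h k)\<^sup>2))"
      by (rule exp_sum) simp
    finally have "(\<integral>w. F w h \<partial>?P) \<le> (\<Prod>k<d. exp (- (\<mu> * \<sigma>2 / 2) * (h k)\<^sup>2))"
      by (simp only: dual)
    then show "ennreal (\<integral>w. F w h \<partial>?P) \<le> (\<Prod>k<d. ennreal (exp (- (\<mu> * \<sigma>2 / 2) * (h k)\<^sup>2)))"
      by (subst prod_ennreal) (auto intro: ennreal_leI)
  qed
  also have "\<dots> = (\<Prod>k<d. \<integral>\<^sup>+ x. ennreal (exp (- (\<mu> * \<sigma>2 / 2) * x\<^sup>2)) \<partial>gauss 1)"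
    by (rule H.product_nn_integral_prod[OF finite_lessThan]) (subst measurable_cong_sets[OF sets_gauss refl], simp)
  also have "\<dots> = (\<Prod>k<d. ennreal (1 / sqrt (1 + \<mu> * \<sigma>2)))"
    using mult_pos_pos[OF \<mu> \<sigma>2] by (subst nn_integral_exp_square_gauss) auto
  also have "\<dots> = ennreal ((1 / sqrt (1 + \<mu> * \<sigma>2)) ^ d)"
    using \<mu> \<sigma>2 by (simp add: ennreal_power)
  finally show ?thesis .
qed

text \<open>A Chernoff bound with parameter m / (2 \<sigma>2), using ln (1 + m) >= m - m^2. The
  resulting exponent is -(d - b)^2 / (8 d), and d - b = t (2 sqrt d - t) >= t sqrt d turns it into
  -t^2 / 8. At t = 0 the claimed probability is 0.\<close>

lemma gaussian_adjoint_tail: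
  fixes a :: "nat \<Rightarrow> nat \<Rightarrow> real" and wt :: "nat \<Rightarrow> 'i"
  assumes K: "finite K" "wt ` {..<n} \<subseteq> K" "inj_on wt {..<n}" and gauss: "\<And>j. j < n \<Longrightarrow> M (wt j) = gauss 1"
    and A: "\<And>v. \<sigma>2 * ip d v v \<le> ip n (\<lambda>j. \<Sum>k<d. v k * a k j) (\<lambda>j. \<Sum>k<d. v k * a k j)"
    and \<sigma>2: "\<sigma>2 > 0" and d: "d > 0" and t: "0 \<le> t" "t \<le> sqrt (real d)"
  shows "measure (PiM K M) {w\<in>space (PiM K M). (\<Sum>k<d. (\<Sum>j<n. w (wt j) * a k j)\<^sup>2) > \<sigma>2 * (sqrt (real d) - t)\<^sup>2}
     \<ge> 1 - exp (- t\<^sup>2 / 8)"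
proof (cases "t = 0")
  case False
  with t have t: "0 < t" "t \<le> sqrt (real d)" by auto
  let ?P = "PiM K M"
  interpret P: prob_space ?P by (rule prob_space_P)
  define Z where "Z w = (\<Sum>k<d. (\<Sum>j<n. w (wt j) * a k j)\<^sup>2)" for w
  have [measurable]: "Z \<in> borel_measurable ?P"
    unfolding Z_def using K by (intro borel_measurable_sum borel_measurable_power borel_measurable_times) auto
  define b where "b = (sqrt (real d) - t)\<^sup>2"
  \<comment> \<open>The maximiser of m (d - b) - d m^2, twice the negated Chernoff exponent.\<close>
  define m where "m = (real d - b) / (2 * real d)"
  have db: "real d - b = t * (2 * sqrt (real d) - t)"
    by (simp add: b_def power2_diff algebra_simps) (simp add: power2_eq_square)
  have db_ge: "real d - b \<ge> t * sqrt (real d)"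
    unfolding db using t by (intro mult_left_mono) auto
  then have db_pos: "real d - b > 0"
    using t d mult_pos_pos[of t "sqrt (real d)"] by linarith
  have b0: "b \<ge> 0" by (simp add: b_def)
  have m: "0 < m" "m \<le> 1" using db_pos b0 d by (auto simp: m_def field_simps)
  have "emeasure ?P {w\<in>space ?P. Z w \<le> \<sigma>2 * b}
     \<le> ennreal (exp (m / (2 * \<sigma>2) * (\<sigma>2 * b))) * (\<integral>\<^sup>+ w. ennreal (exp (- (m / (2 * \<sigma>2)) * Z w)) * indicator (space ?P) w \<partial>?P)"
    by (rule Chernoff_ineq_nn_integral_le) (use m \<sigma>2 in auto)
  also have "(\<integral>\<^sup>+ w. ennreal (exp (- (m / (2 * \<sigma>2)) * Z w)) * indicator (space ?P) w \<partial>?P)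
      = (\<integral>\<^sup>+ w. ennreal (exp (- (m / \<sigma>2 / 2) * Z w)) \<partial>?P)"
    by (intro nn_integral_cong) (auto simp: mult.commute)
  also have "\<dots> \<le> ennreal ((1 / sqrt (1 + m / \<sigma>2 * \<sigma>2)) ^ d)"
    unfolding Z_def by (intro nn_integral_exp_adjoint K gauss A) (use m \<sigma>2 in auto)
  also have "\<dots> \<le> ennreal (exp (- real d * (m - m\<^sup>2) / 2))"
  proof (intro ennreal_leI)
    have "exp (m - m\<^sup>2) \<le> 1 + m"
      using ln_one_plus_pos_lower_bound[of m] m by (subst ln_ge_iff[symmetric]) auto
    then have "sqrt (exp (m - m\<^sup>2)) \<le> sqrt (1 + m)" by simp
    also have "sqrt (exp (m - m\<^sup>2)) = exp ((m - m\<^sup>2) / 2)"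
      by (rule real_sqrt_unique) (simp_all add: power2_eq_square mult_exp_exp)
    finally have "1 / sqrt (1 + m) \<le> 1 / exp ((m - m\<^sup>2) / 2)"
      using m by (intro divide_left_mono) auto
    then have "1 / sqrt (1 + m) \<le> exp (- ((m - m\<^sup>2) / 2))"
      by (simp add: exp_minus inverse_eq_divide)
    then have "(1 / sqrt (1 + m)) ^ d \<le> exp (- ((m - m\<^sup>2) / 2)) ^ d"
      using m by (intro power_mono) auto
    also have "\<dots> = exp (- real d * (m - m\<^sup>2) / 2)"
      by (simp add: exp_of_nat_mult[symmetric])
    finally show "(1 / sqrt (1 + m / \<sigma>2 * \<sigma>2)) ^ d \<le> exp (- real d * (m - m\<^sup>2) / 2)"
      using \<sigma>2 by simp
  qed
  also have "ennreal (exp (m / (2 * \<sigma>2) * (\<sigma>2 * b))) * ennreal (exp (- real d * (m - m\<^sup>2) / 2))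
     = ennreal (exp (- (real d - b)\<^sup>2 / (8 * real d)))"
  proof -
    have "m / (2 * \<sigma>2) * (\<sigma>2 * b) + - real d * (m - m\<^sup>2) / 2 = - (m * (real d - b - real d * m)) / 2"
      using \<sigma>2 by (simp add: field_simps power2_eq_square)
    also have "real d * m = (real d - b) / 2" using d by (simp add: m_def)
    also have "- (m * (real d - b - (real d - b) / 2)) / 2 = - (real d - b)\<^sup>2 / (8 * real d)"
    proof -
      have "- (x / (2 * real d) * (x - x / 2)) / 2 = - x\<^sup>2 / (8 * real d)" for x
        by (simp add: power2_eq_square)
      then show ?thesis unfolding m_def .
    qed
    finally have "m / (2 * \<sigma>2) * (\<sigma>2 * b) + - real d * (m - m\<^sup>2) / 2 = - (real d - b)\<^sup>2 / (8 * real d)" .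
    then show ?thesis by (simp only: ennreal_mult[symmetric] exp_ge_zero mult_exp_exp)
  qed
  also have "\<dots> \<le> ennreal (exp (- t\<^sup>2 / 8))"
  proof -
    have "(t * sqrt (real d))\<^sup>2 \<le> (real d - b)\<^sup>2"
      using db_ge t by (intro power_mono) auto
    then have "t\<^sup>2 \<le> (real d - b)\<^sup>2 / real d"
      using d by (simp add: power_mult_distrib field_simps)
    then show ?thesis by (intro ennreal_leI) (simp add: field_simps)
  qed
  finally have "measure ?P {w\<in>space ?P. Z w \<le> \<sigma>2 * b} \<le> exp (- t\<^sup>2 / 8)"
    by (auto simp: P.emeasure_eq_measure mult_left_mono)
  moreover have "measure ?P {w\<in>space ?P. \<not> (Z w \<le> \<sigma>2 * b)} = 1 - measure ?P {w\<in>space ?P. Z w \<le> \<sigma>2 * b}"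
    by (rule P.prob_neg) measurable
  ultimately show ?thesis by (simp add: not_le Z_def b_def)
qed simp

end

section \<open>The network near an input\<close>

text \<open>The dimension of the input of layer \<open>l\<close>, not of its output; this is why 0
  is the special value.\<close>

definition width :: "nat \<Rightarrow> nat \<Rightarrow> nat \<Rightarrow> nat" where
  "width d N l = (if l = 0 then d else N)"

text \<open>Post-activation input of layer \<open>l\<close>, so that \<open>act 0\<close> is the network input.\<close>
fun act :: "nat \<Rightarrow> nat \<Rightarrow> (param \<Rightarrow> real) \<Rightarrow> (nat \<Rightarrow> real) \<Rightarrow> nat \<Rightarrow> nat \<Rightarrow> real" where
  "act d N w x 0 j = x j"
| "act d N w x (Suc l) i = relu (pre d N w x l i)"

text \<open>Derivative of \<open>act\<close> in direction \<open>v\<close>, provided that no pre-activation vanishes at \<open>x\<close>.\<close>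
fun tang :: "nat \<Rightarrow> nat \<Rightarrow> (param \<Rightarrow> real) \<Rightarrow> (nat \<Rightarrow> real) \<Rightarrow> (nat \<Rightarrow> real) \<Rightarrow> nat \<Rightarrow> nat \<Rightarrow> real" where
  "tang d N w x v 0 j = v j"
| "tang d N w x v (Suc l) i =
     (if pre d N w x l i > 0 then \<Sum>j<width d N l. w (Wt l i j) * tang d N w x v l j else 0)"

text \<open>Joins the two clauses of \<open>pre\<close>, so that inductions over layers need no
  separate treatment of the first affine map.\<close>

lemma pre_act: "pre d N w x l i = (\<Sum>j<width d N l. w (Wt l i j) * act d N w x l j) + w (Bs l i)"
  by (cases l) (auto simp: width_def)

declare pre.simps [simp del]

text \<open>The tangents in the \<open>d\<close> unit directions span the image of the differential;
  they are the family \<open>a\<close> to which the single-layer estimate is applied. The bound on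
  \<open>j\<close> matters at layer 0, where coordinates beyond \<open>d\<close> are not
  spanned.\<close>

lemma tang_linear:
  "j < width d N l \<Longrightarrow> tang d N w x v l j = (\<Sum>k<d. v k * tang d N w x (\<lambda>m. if m = k then 1 else 0) l j)"
proof (induction l arbitrary: j)
  case 0
  then show ?case by (simp add: width_def if_distrib cong: if_cong)
next
  case (Suc l)
  have "(\<Sum>m<width d N l. w (Wt l j m) * tang d N w x v l m)
    = (\<Sum>m<width d N l. \<Sum>k<d. v k * (w (Wt l j m) * tang d N w x (\<lambda>m. if m = k then 1 else 0) l m))"
    by (rule sum.cong) (simp_all add: Suc.IH sum_distrib_left mult_ac)
  also have "\<dots> = (\<Sum>k<d. \<Sum>m<width d N l. v k * (w (Wt l j m) * tang d N w x (\<lambda>m. if m = k then 1 else 0) l m))"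
    by (rule sum.swap)
  finally show ?case by (simp add: sum_distrib_left)
qed

lemma act_cong:
  assumes "\<And>j. j < d \<Longrightarrow> x j = y j"
  shows "j < width d N l \<Longrightarrow> act d N w x l j = act d N w y l j"
proof (induction l arbitrary: j)
  case (Suc l)
  have "pre d N w x l j = pre d N w y l j"
    unfolding pre_act using Suc.IH by simp
  then show ?case by simp
qed (use assms in \<open>simp add: width_def\<close>)

lemma net_cong: "(\<And>j. j < d \<Longrightarrow> x j = y j) \<Longrightarrow> net d N L w x = net d N L w y"
  unfolding net_def pre_act using act_cong[of d x y] by simp

section \<open>Dependence on the parameters of lower layers\<close>

definition lower_params :: "nat \<Rightarrow> nat \<Rightarrow> nat \<Rightarrow> param set" where
  "lower_params d N l = (\<Union>m<l. layer m (width d N m) N)"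

lemma lower_params_Suc: "lower_params d N (Suc l) = lower_params d N l \<union> layer l (width d N l) N"
  by (auto simp: lower_params_def less_Suc_eq)

lemma finite_lower_params: "finite (lower_params d N l)"
  by (simp add: lower_params_def finite_layer)

lemma lower_params_mono: "m \<le> l \<Longrightarrow> lower_params d N m \<subseteq> lower_params d N l"
  unfolding lower_params_def by (intro UN_mono) auto

lemma Wt_in_lower_params: "l < m \<Longrightarrow> i < N \<Longrightarrow> j < width d N l \<Longrightarrow> Wt l i j \<in> lower_params d N m"
  and Bs_in_lower_params: "l < m \<Longrightarrow> i < N \<Longrightarrow> Bs l i \<in> lower_params d N m"
  by (auto simp: lower_params_def layer_def)

lemma act_tang_local:
  assumes "\<And>k. k \<in> lower_params d N l \<Longrightarrow> w k = w' k"
  shows "j < width d N l \<Longrightarrow> act d N w x l j = act d N w' x l j \<and> tang d N w x v l j = tang d N w' x v l j"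
  using assms
proof (induction l arbitrary: j)
  case (Suc l)
  have IH: "act d N w x l m = act d N w' x l m \<and> tang d N w x v l m = tang d N w' x v l m"
    if "m < width d N l" for m
    using that Suc.prems(2) lower_params_mono[of l "Suc l" d N] by (intro Suc.IH) auto
  have j: "j < N" using Suc.prems by (simp add: width_def)
  have w: "w (Wt l j m) = w' (Wt l j m)" if "m < width d N l" for m
    using Suc.prems(2) Wt_in_lower_params[of l "Suc l"] j that by simp
  have "w (Bs l j) = w' (Bs l j)"
    using Suc.prems(2) Bs_in_lower_params[of l "Suc l"] j by simp
  then have "pre d N w x l j = pre d N w' x l j"
    unfolding pre_act using IH w by simp
  then show ?case using IH w by simp
qed simp

lemma pre_local:
  assumes "\<And>k. k \<in> lower_params d N (Suc l) \<Longrightarrow> w k = w' k" "i < N"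
  shows "pre d N w x l i = pre d N w' x l i"
proof -
  have w: "w k = w' k" if "k \<in> lower_params d N l" for k
    using assms(1) lower_params_mono[of l "Suc l" d N] that by auto
  have "act d N w x l j = act d N w' x l j" if "j < width d N l" for j
    using act_tang_local[of d N l w w' j x undefined, OF w that] by simp
  moreover have "w (Wt l i j) = w' (Wt l i j)" if "j < width d N l" for j
    using assms Wt_in_lower_params[of l "Suc l" i N] that by simp
  moreover have "w (Bs l i) = w' (Bs l i)"
    using assms Bs_in_lower_params[of l "Suc l" i N] by simp
  ultimately show ?thesis
    unfolding pre_act by simp
qed

text \<open>A nonzero pre-activation keeps its sign for small \<open>h\<close>, so each relu is
  either the identity or zero along the segment. Only finitely many neurons have to agree on how
  small \<open>h\<close> must be.\<close>

lemma eventually_act_affine: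
  assumes "\<And>m i. m < l \<Longrightarrow> i < N \<Longrightarrow> pre d N w x m i \<noteq> 0"
  shows "\<forall>\<^sub>F h in at_right 0. \<forall>j\<in>{..<width d N l}.
    act d N w (\<lambda>k. x k + h * v k) l j = act d N w x l j + h * tang d N w x v l j"
  using assms
proof (induction l)
  case (Suc l)
  have IH: "\<forall>\<^sub>F h in at_right 0. \<forall>j\<in>{..<width d N l}.
    act d N w (\<lambda>k. x k + h * v k) l j = act d N w x l j + h * tang d N w x v l j"
    using Suc by simp
  show ?case
  proof (rule eventually_ball_finite[OF finite_lessThan], rule ballI)
    fix j assume "j \<in> {..<width d N (Suc l)}"
    then have j: "j < N" by (simp add: width_def)
    define p where "p = pre d N w x l j"
    define c where "c = (\<Sum>m<width d N l. w (Wt l j m) * tang d N w x v l m)"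
    have p0: "p \<noteq> 0" using Suc.prems[of l j] j by (simp add: p_def)
    have lim: "((\<lambda>h. p + h * c) \<longlongrightarrow> p + 0 * c) (at_right 0)"
      by (intro tendsto_intros)
    show "\<forall>\<^sub>F h in at_right 0. act d N w (\<lambda>k. x k + h * v k) (Suc l) j = act d N w x (Suc l) j + h * tang d N w x v (Suc l) j"
    proof (cases "p > 0")
      case True
      then have "\<forall>\<^sub>F h in at_right 0. p + h * c > 0"
        using order_tendstoD(1)[OF lim] by simp
      then show ?thesis using IH
      proof eventually_elim
        case (elim h)
        have "pre d N w (\<lambda>k. x k + h * v k) l j = p + h * c"
          unfolding pre_act p_def c_def using elim(2)
          by (simp add: algebra_simps sum.distrib sum_distrib_left)
        then show ?case using elim(1) True by (simp add: p_def c_def relu_def)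
      qed
    next
      case False
      then have "p < 0" using p0 by simp
      then have "\<forall>\<^sub>F h in at_right 0. p + h * c < 0"
        using order_tendstoD(2)[OF lim] by simp
      then show ?thesis using IH
      proof eventually_elim
        case (elim h)
        have "pre d N w (\<lambda>k. x k + h * v k) l j = p + h * c"
          unfolding pre_act p_def c_def using elim(2)
          by (simp add: algebra_simps sum.distrib sum_distrib_left)
        then show ?case using elim(1) False p0 by (simp add: p_def c_def relu_def)
      qed
    qed
  qed
qed simp

section \<open>Lower bounds for the Lipschitz constant\<close>

lemma enorm_eq: "enorm d v = sqrt (ip d v v)"
  by (simp add: enorm_def ip_def power2_eq_square)

lemma Lip_upper: "x \<in> Rvec d \<Longrightarrow> y \<in> Rvec d \<Longrightarrow> x \<noteq> y \<Longrightarrow>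
   ereal (\<bar>f x - f y\<bar> / enorm d (\<lambda>j. x j - y j)) \<le> Lip d f"
  unfolding Lip_def by (intro Sup_upper) auto

text \<open>With \<open>d\<close> >= 1 there are two distinct points; over an empty set the supremum
  in \<open>ereal\<close> would be minus infinity.\<close>

lemma Lip_nonneg: "d \<ge> 1 \<Longrightarrow> 0 \<le> Lip d f"
proof -
  assume d: "d \<ge> 1"
  let ?x = "restrict (\<lambda>_. 0 :: real) {..<d}" and ?y = "restrict (\<lambda>_. 1 :: real) {..<d}"
  have "?x 0 \<noteq> ?y 0" using d by simp
  then have ne: "?x \<noteq> ?y" by metis
  have "0 \<le> ereal (\<bar>f ?x - f ?y\<bar> / enorm d (\<lambda>j. ?x j - ?y j))"
    by (simp add: enorm_eq)
  also have "\<dots> \<le> Lip d f"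
    by (rule Lip_upper[OF _ _ ne]) (auto simp: Rvec_def)
  finally show ?thesis .
qed

text \<open>Moving from \<open>x\<close> by a small multiple \<open>h\<close> of the gradient
  \<open>g\<close> itself changes the output by h |g|^2 over a distance h |g|. A zero gradient
  leaves only nonnegativity to check.\<close>

lemma Lip_ge_gradient:
  fixes w :: "param \<Rightarrow> real"
  assumes d: "d \<ge> 1" and x: "x \<in> Rvec d"
    and ne: "\<And>m i. m < L \<Longrightarrow> i < N \<Longrightarrow> pre d N w x m i \<noteq> 0"
  defines "g \<equiv> \<lambda>k. \<Sum>j<width d N L. w (Wt L 0 j) * tang d N w x (\<lambda>m. if m = k then 1 else 0) L j"
  shows "ereal (enorm d g) \<le> Lip d (net d N L w)"
proof (cases "ip d g g = 0")
  case True
  then show ?thesis using Lip_nonneg[OF d] by (simp add: enorm_eq zero_ereal_def[symmetric])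
next
  case False
  then have pos: "ip d g g > 0" using ip_self_nonneg[of d g] by linarith
  have "\<forall>\<^sub>F h in at_right 0. 0 < h \<and> (\<forall>j\<in>{..<width d N L}.
      act d N w (\<lambda>k. x k + h * g k) L j = act d N w x L j + h * tang d N w x g L j)"
    by (intro eventually_conj eventually_act_affine eventually_at_right_less ne)
  then obtain h where "0 < h \<and> (\<forall>j\<in>{..<width d N L}.
      act d N w (\<lambda>k. x k + h * g k) L j = act d N w x L j + h * tang d N w x g L j)"
    using eventually_happens'[OF trivial_limit_at_right_real] by blast
  then have h: "h > 0" "\<And>j. j < width d N L \<Longrightarrow>
      act d N w (\<lambda>k. x k + h * g k) L j = act d N w x L j + h * tang d N w x g L j"
    by simp_all
  \<comment> \<open>Membership in \<open>Rvec\<close> fixes the values outside the first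
    \<open>d\<close> coordinates, so the displaced point is restricted; the network does not see the
    difference.\<close>
  define y where "y = restrict (\<lambda>k. x k + h * g k) {..<d}"
  have y: "y \<in> Rvec d" by (simp add: y_def Rvec_def)
  have "net d N L w y = net d N L w (\<lambda>k. x k + h * g k)"
    by (rule net_cong) (simp add: y_def)
  also have "\<dots> = net d N L w x + h * (\<Sum>j<width d N L. w (Wt L 0 j) * tang d N w x g L j)"
    unfolding net_def pre_act using h(2) by (simp add: algebra_simps sum.distrib sum_distrib_left)
  also have "(\<Sum>j<width d N L. w (Wt L 0 j) * tang d N w x g L j)
    = (\<Sum>j<width d N L. \<Sum>k<d. g k * (w (Wt L 0 j) * tang d N w x (\<lambda>m. if m = k then 1 else 0) L j))"
    by (rule sum.cong) (simp_all add: tang_linear[of _ d N L w x g] sum_distrib_left mult_ac)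
  also have "\<dots> = (\<Sum>k<d. \<Sum>j<width d N L. g k * (w (Wt L 0 j) * tang d N w x (\<lambda>m. if m = k then 1 else 0) L j))"
    by (rule sum.swap)
  also have "\<dots> = ip d g g"
    by (simp add: ip_def g_def sum_distrib_left)
  finally have diff: "net d N L w y - net d N L w x = h * ip d g g" by simp
  have "enorm d (\<lambda>j. y j - x j) = sqrt (ip d (\<lambda>j. h * g j) (\<lambda>j. h * g j))"
    by (simp add: enorm_eq ip_def y_def)
  also have "\<dots> = h * sqrt (ip d g g)"
    using h(1) by (simp add: ip_scale_left ip_scale_right real_sqrt_mult)
  finally have en: "enorm d (\<lambda>j. y j - x j) = h * sqrt (ip d g g)" .
  have "y \<noteq> x"
    using diff h(1) pos by auto
  then have "ereal (\<bar>net d N L w y - net d N L w x\<bar> / enorm d (\<lambda>j. y j - x j)) \<le> Lip d (net d N L w)"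
    by (rule Lip_upper[OF y x])
  also have "\<bar>net d N L w y - net d N L w x\<bar> / enorm d (\<lambda>j. y j - x j) = enorm d g"
    using h(1) pos unfolding diff en unfolding enorm_eq by (simp add: abs_mult real_div_sqrt)
  finally show ?thesis .
qed

section \<open>Countable reductions for measurability\<close>

definition rat_vectors :: "nat \<Rightarrow> (nat \<Rightarrow> real) set" where
  "rat_vectors d = PiE {..<d} (\<lambda>_. \<rat>)"

lemma countable_rat_vectors: "countable (rat_vectors d)"
  unfolding rat_vectors_def by (intro countable_PiE) (auto simp: countable_rat)

lemma rat_vectors_Rvec: "x \<in> rat_vectors d \<Longrightarrow> x \<in> Rvec d"
  by (simp add: rat_vectors_def Rvec_def PiE_iff)

lemma rat_vectors_dense:
  obtains X where "\<And>n. X n \<in> rat_vectors d" "\<And>j. j < d \<Longrightarrow> (\<lambda>n. X n j) \<longlonglongrightarrow> v j"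
proof
  define X where "X n = restrict (\<lambda>j. of_int \<lfloor>v j * real (Suc n)\<rfloor> / real (Suc n)) {..<d}" for n
  show "X n \<in> rat_vectors d" for n
    by (auto simp: X_def rat_vectors_def)
  fix j assume j: "j < d"
  show "(\<lambda>n. X n j) \<longlonglongrightarrow> v j"
  proof (rule tendsto_sandwich)
    have "v j - inverse (real (Suc n)) \<le> X n j \<and> X n j \<le> v j" for n
    proof -
      define s where "s = real (Suc n)"
      have "s > 0" by (simp add: s_def)
      have Xe: "X n j = of_int \<lfloor>v j * s\<rfloor> / s" using j by (simp add: X_def s_def)
      have "(v j * s - 1) / s \<le> X n j"
        unfolding Xe using \<open>s > 0\<close> by (intro divide_right_mono) linarith+
      moreover have "X n j \<le> v j * s / s"
        unfolding Xe using \<open>s > 0\<close> by (intro divide_right_mono) linarith+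
      ultimately show ?thesis
        using \<open>s > 0\<close> unfolding s_def[symmetric] by (simp add: diff_divide_distrib inverse_eq_divide)
    qed
    then show "\<forall>\<^sub>F n in sequentially. v j - inverse (real (Suc n)) \<le> X n j" "\<forall>\<^sub>F n in sequentially. X n j \<le> v j"
      by auto
    show "(\<lambda>n. v j - inverse (real (Suc n))) \<longlonglongrightarrow> v j"
      using tendsto_diff[OF tendsto_const LIMSEQ_inverse_real_of_nat, of "v j"] by simp
  qed simp
qed

lemma tendsto_act:
  assumes "\<And>j. j < d \<Longrightarrow> (\<lambda>n. X n j) \<longlonglongrightarrow> x j"
  shows "j < width d N l \<Longrightarrow> (\<lambda>n. act d N w (X n) l j) \<longlonglongrightarrow> act d N w x l j"
proof (induction l arbitrary: j)
  case 0
  then show ?case using assms by (simp add: width_def)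
next
  case (Suc l)
  have "(\<lambda>n. pre d N w (X n) l j) \<longlonglongrightarrow> pre d N w x l j"
    unfolding pre_act by (intro tendsto_intros Suc.IH) simp
  then show ?case by (auto simp: relu_def intro!: tendsto_intros)
qed

lemma tendsto_net:
  assumes "\<And>j. j < d \<Longrightarrow> (\<lambda>n. X n j) \<longlonglongrightarrow> x j"
  shows "(\<lambda>n. net d N L w (X n)) \<longlonglongrightarrow> net d N L w x"
  unfolding net_def pre_act by (intro tendsto_intros tendsto_act assms) auto

lemma tendsto_ip:
  assumes "\<And>j. j < n \<Longrightarrow> (\<lambda>m. X m j) \<longlonglongrightarrow> x j" "\<And>j. j < n \<Longrightarrow> (\<lambda>m. Y m j) \<longlonglongrightarrow> y j"
  shows "(\<lambda>m. ip n (X m) (Y m)) \<longlonglongrightarrow> ip n x y"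
  unfolding ip_def by (intro tendsto_intros assms) auto

lemma tendsto_tang:
  assumes "\<And>j. j < d \<Longrightarrow> (\<lambda>n. V n j) \<longlonglongrightarrow> v j" "j < width d N l"
  shows "(\<lambda>n. tang d N w x (V n) l j) \<longlonglongrightarrow> tang d N w x v l j"
  unfolding tang_linear[OF assms(2), of w x v] tang_linear[OF assms(2), of w x "V _"]
  by (intro tendsto_intros assms(1)) auto

text \<open>Difference quotients are continuous away from the diagonal, so rational points attain
  the same supremum. As a countable supremum, the Lipschitz constant is measurable in the
  parameters.\<close>

lemma Lip_net_eq_rational_SUP:
  "Lip d (net d N L w) = (SUP (x, y)\<in>{(x, y). x \<in> rat_vectors d \<and> y \<in> rat_vectors d \<and> x \<noteq> y}.
      ereal (\<bar>net d N L w x - net d N L w y\<bar> / enorm d (\<lambda>j. x j - y j)))" (is "_ = ?S")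
proof (rule antisym)
  show "?S \<le> Lip d (net d N L w)"
    by (rule SUP_least) (auto intro: Lip_upper rat_vectors_Rvec)
  show "Lip d (net d N L w) \<le> ?S"
    unfolding Lip_def
  proof (rule Sup_least, safe)
    fix x y assume xy: "x \<in> Rvec d" "y \<in> Rvec d" "x \<noteq> y"
    obtain X where X: "\<And>n. X n \<in> rat_vectors d" "\<And>j. j < d \<Longrightarrow> (\<lambda>n. X n j) \<longlonglongrightarrow> x j"
      by (rule rat_vectors_dense[of d x]) (rule that)
    obtain Y where Y: "\<And>n. Y n \<in> rat_vectors d" "\<And>j. j < d \<Longrightarrow> (\<lambda>n. Y n j) \<longlonglongrightarrow> y j"
      by (rule rat_vectors_dense[of d y]) (rule that)
    obtain j where j: "j < d" "x j \<noteq> y j"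
      using xy PiE_ext[of x "{..<d}" "\<lambda>_. UNIV" y] by (auto simp: Rvec_def)
    have "ip d (\<lambda>j. x j - y j) (\<lambda>j. x j - y j) \<noteq> 0"
      using j by (auto simp: ip_self_eq_0_iff)
    then have en: "enorm d (\<lambda>j. x j - y j) \<noteq> 0" by (simp add: enorm_eq)
    have lim: "(\<lambda>n. ereal (\<bar>net d N L w (X n) - net d N L w (Y n)\<bar> / enorm d (\<lambda>j. X n j - Y n j)))
       \<longlonglongrightarrow> ereal (\<bar>net d N L w x - net d N L w y\<bar> / enorm d (\<lambda>j. x j - y j))"
      using en unfolding enorm_eq
      by (intro tendsto_intros tendsto_net tendsto_ip X(2) Y(2)) auto
    \<comment> \<open>The approximants of two distinct points may coincide at first; a coordinate
      where the limits differ separates them eventually.\<close>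
    have "(\<lambda>n. X n j - Y n j) \<longlonglongrightarrow> x j - y j"
      by (intro tendsto_intros X(2) Y(2) j)
    then have "\<forall>\<^sub>F n in sequentially. X n j - Y n j \<noteq> 0"
      using j by (intro tendsto_imp_eventually_ne) auto
    then have "\<forall>\<^sub>F n in sequentially. ereal (\<bar>net d N L w (X n) - net d N L w (Y n)\<bar> / enorm d (\<lambda>j. X n j - Y n j)) \<le> ?S"
    proof eventually_elim
      case (elim n)
      then have "(X n, Y n) \<in> {(x, y). x \<in> rat_vectors d \<and> y \<in> rat_vectors d \<and> x \<noteq> y}"
        using X(1) Y(1) by auto
      then show ?case by (rule SUP_upper2) simp
    qed
    then show "ereal (\<bar>net d N L w x - net d N L w y\<bar> / enorm d (\<lambda>j. x j - y j)) \<le> ?S"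
      by (rule tendsto_upperbound[OF lim]) simp
  qed
qed

section \<open>Probability of the good events\<close>

text \<open>Stands in for conditional probability: over each point of \<open>A\<close> the section
  of \<open>F\<close> has mass at least \<open>p\<close>, and integrating the sections gives the
  bound. The witness \<open>B\<close> may depend on \<open>x\<close> arbitrarily, because only the
  section of \<open>F\<close> itself enters the integral.\<close>

lemma (in symmetric_params) measure_PiM_Un_ge:
  assumes IJ: "I \<inter> J = {}" "finite I" "finite J"
    and A: "A \<in> sets (PiM I M)" and F: "F \<in> sets (PiM (I \<union> J) M)" and p: "p \<ge> 0"
    and B: "\<And>x. x \<in> A \<Longrightarrow> \<exists>B\<in>sets (PiM J M). p \<le> measure (PiM J M) B \<and> (\<forall>y\<in>B. merge I J (x, y) \<in> F)"
  shows "p * measure (PiM I M) A \<le> measure (PiM (I \<union> J) M) F"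
proof -
  interpret PI: prob_space "PiM I M" by (rule prob_space_P)
  interpret PJ: prob_space "PiM J M" by (rule prob_space_P)
  interpret PU: prob_space "PiM (I \<union> J) M" by (rule prob_space_P)
  have "ennreal (p * measure (PiM I M) A) = (\<integral>\<^sup>+ x. ennreal p * indicator A x \<partial>PiM I M)"
    using A p by (simp add: nn_integral_cmult PI.emeasure_eq_measure ennreal_mult)
  also have "\<dots> \<le> (\<integral>\<^sup>+ x. (\<integral>\<^sup>+ y. indicator F (merge I J (x, y)) \<partial>PiM J M) \<partial>PiM I M)"
  proof (intro nn_integral_mono)
    fix x
    show "ennreal p * indicator A x \<le> (\<integral>\<^sup>+ y. indicator F (merge I J (x, y)) \<partial>PiM J M)"
    proof (cases "x \<in> A")
      case True
      then obtain B' where B': "B' \<in> sets (PiM J M)" "p \<le> measure (PiM J M) B'" "\<forall>y\<in>B'. merge I J (x, y) \<in> F"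
        using B by blast
      have "ennreal p \<le> emeasure (PiM J M) B'"
        using B' by (simp add: PJ.emeasure_eq_measure)
      also have "\<dots> = (\<integral>\<^sup>+ y. indicator B' y \<partial>PiM J M)"
        using B' by simp
      also have "\<dots> \<le> (\<integral>\<^sup>+ y. indicator F (merge I J (x, y)) \<partial>PiM J M)"
        using B' by (intro nn_integral_mono) (auto simp: indicator_def)
      finally show ?thesis using True by simp
    qed simp
  qed
  also have "\<dots> = (\<integral>\<^sup>+ w. indicator F w \<partial>PiM (I \<union> J) M)"
    using F by (intro product_nn_integral_fold[symmetric] IJ) simp
  also have "\<dots> = ennreal (measure (PiM (I \<union> J) M) F)"
    using F by (simp add: PU.emeasure_eq_measure)
  finally show ?thesis by simp
qed

section \<open>Induction over the hidden layers\<close>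

locale gaussian_network = symmetric_params M for M :: "param \<Rightarrow> real measure" +
  fixes d N L :: nat
  assumes d_pos: "d \<ge> 1" and N_pos: "N \<ge> 1"
    and gauss_hidden: "\<And>l i j. l < L \<Longrightarrow> i < N \<Longrightarrow> j < width d N l \<Longrightarrow> M (Wt l i j) = gauss (sqrt (2 / real N))"
    and gauss_out: "\<And>j. j < N \<Longrightarrow> M (Wt L 0 j) = gauss 1"
begin

lemma act_measurable:
  assumes "lower_params d N l \<subseteq> K" "j < width d N l"
  shows "(\<lambda>w. act d N w x l j) \<in> borel_measurable (PiM K M)"
    and "(\<lambda>w. tang d N w x v l j) \<in> borel_measurable (PiM K M)"
proof -
  have "(\<lambda>w. act d N w x l j) \<in> borel_measurable (PiM K M) \<and> (\<lambda>w. tang d N w x v l j) \<in> borel_measurable (PiM K M)"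
    using assms
  proof (induction l arbitrary: j)
    case (Suc l)
    have K: "lower_params d N l \<subseteq> K"
      using Suc.prems(1) lower_params_mono[of l "Suc l" d N] by auto
    have j: "j < N" using Suc.prems by (simp add: width_def)
    have mem: "Wt l j m \<in> K" if "m < width d N l" for m
      using Suc.prems(1) Wt_in_lower_params[OF lessI j that] by auto
    have mem_Bs: "Bs l j \<in> K"
      using Suc.prems(1) Bs_in_lower_params[OF lessI j] by auto
    have a: "(\<lambda>w. act d N w x l m) \<in> borel_measurable (PiM K M)" if "m < width d N l" for m
      using Suc.IH[OF K that] by simp
    have t: "(\<lambda>w. tang d N w x v l m) \<in> borel_measurable (PiM K M)" if "m < width d N l" for m
      using Suc.IH[OF K that] by simp
    have p [measurable]: "(\<lambda>w. pre d N w x l j) \<in> borel_measurable (PiM K M)"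
      unfolding pre_act
      by (intro borel_measurable_add borel_measurable_sum borel_measurable_times coordinate_measurable a mem mem_Bs) auto
    have s [measurable]: "(\<lambda>w. \<Sum>m<width d N l. w (Wt l j m) * tang d N w x v l m) \<in> borel_measurable (PiM K M)"
      by (intro borel_measurable_sum borel_measurable_times coordinate_measurable t mem) auto
    show ?case by (simp add: relu_def)
  qed simp
  then show "(\<lambda>w. act d N w x l j) \<in> borel_measurable (PiM K M)"
    and "(\<lambda>w. tang d N w x v l j) \<in> borel_measurable (PiM K M)" by auto
qed

lemma pre_measurable:
  assumes "lower_params d N l \<subseteq> K" "Bs l i \<in> K" "\<And>j. j < width d N l \<Longrightarrow> Wt l i j \<in> K"
  shows "(\<lambda>w. pre d N w x l i) \<in> borel_measurable (PiM K M)"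
  unfolding pre_act using assms
  by (intro borel_measurable_add borel_measurable_sum borel_measurable_times coordinate_measurable act_measurable) auto

definition x0 :: "nat \<Rightarrow> real" where
  "x0 = restrict (\<lambda>_. 1) {..<d}"

text \<open>The second condition says that the smallest singular value of the differential at
  \<open>x0\<close> up to layer \<open>l\<close> is at least |s|^l, written with squares and without
  square roots.\<close>

definition good :: "real \<Rightarrow> nat \<Rightarrow> (param \<Rightarrow> real) set" where
  "good s l = {w \<in> space (PiM (lower_params d N l) M).
      (\<forall>m<l. \<forall>i<N. pre d N w x0 m i \<noteq> 0) \<and>
      (\<forall>v. (s\<^sup>2) ^ l * ip d v v \<le> ip (width d N l) (tang d N w x0 v l) (tang d N w x0 v l))}"

text \<open>The quantifier over all directions is uncountable; by continuity of the tangent in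
  \<open>v\<close> it may be restricted to rational directions.\<close>

lemma good_sets: "good s l \<in> sets (PiM (lower_params d N l) M)"
proof -
  let ?P = "PiM (lower_params d N l) M"
  have rat: "(\<forall>v. (s\<^sup>2) ^ l * ip d v v \<le> ip (width d N l) (tang d N w x0 v l) (tang d N w x0 v l))
     \<longleftrightarrow> (\<forall>v\<in>rat_vectors d. (s\<^sup>2) ^ l * ip d v v \<le> ip (width d N l) (tang d N w x0 v l) (tang d N w x0 v l))" for w
  proof (intro iffI allI)
    fix v assume le: "\<forall>v\<in>rat_vectors d. (s\<^sup>2) ^ l * ip d v v \<le> ip (width d N l) (tang d N w x0 v l) (tang d N w x0 v l)"
    obtain X where X: "\<And>n. X n \<in> rat_vectors d" "\<And>j. j < d \<Longrightarrow> (\<lambda>n. X n j) \<longlonglongrightarrow> v j"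
      by (rule rat_vectors_dense[of d v]) (rule that)
    have "(\<lambda>n. (s\<^sup>2) ^ l * ip d (X n) (X n)) \<longlonglongrightarrow> (s\<^sup>2) ^ l * ip d v v"
      by (intro tendsto_intros tendsto_ip X(2))
    moreover have "(\<lambda>n. ip (width d N l) (tang d N w x0 (X n) l) (tang d N w x0 (X n) l))
       \<longlonglongrightarrow> ip (width d N l) (tang d N w x0 v l) (tang d N w x0 v l)"
      by (intro tendsto_ip tendsto_tang X(2))
    ultimately show "(s\<^sup>2) ^ l * ip d v v \<le> ip (width d N l) (tang d N w x0 v l) (tang d N w x0 v l)"
      by (rule LIMSEQ_le) (use le X(1) in blast)
  qed simp
  have pre: "{w \<in> space ?P. pre d N w x0 m i \<noteq> 0} \<in> sets ?P" if "m \<in> {..<l}" "i \<in> {..<N}" for m i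
  proof -
    have [measurable]: "(\<lambda>w. pre d N w x0 m i) \<in> borel_measurable ?P"
      using that by (intro pre_measurable lower_params_mono Wt_in_lower_params Bs_in_lower_params) auto
    show ?thesis by measurable
  qed
  have tang: "{w \<in> space ?P. (s\<^sup>2) ^ l * ip d v v \<le> ip (width d N l) (tang d N w x0 v l) (tang d N w x0 v l)} \<in> sets ?P" for v
  proof -
    have [measurable]: "(\<lambda>w. ip (width d N l) (tang d N w x0 v l) (tang d N w x0 v l)) \<in> borel_measurable ?P"
      unfolding ip_def by (intro borel_measurable_sum borel_measurable_times act_measurable) auto
    show ?thesis by measurable
  qed
  have "good s l = {w \<in> space ?P. (\<forall>m\<in>{..<l}. \<forall>i\<in>{..<N}. pre d N w x0 m i \<noteq> 0) \<and>
      (\<forall>v\<in>rat_vectors d. (s\<^sup>2) ^ l * ip d v v \<le> ip (width d N l) (tang d N w x0 v l) (tang d N w x0 v l))}"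
    unfolding good_def rat by auto
  also have "\<dots> \<in> sets ?P"
    by (intro sets.sets_Collect_conj sets.sets_Collect_finite_All' sets.sets_Collect_countable_All'
        countable_rat_vectors pre tang) auto
  finally show ?thesis .
qed

text \<open>If all activations of a layer were zero, no neuron would be active and every tangent
  would vanish, contradicting the lower bound in \<open>good\<close>. The induction thus supplies
  the nonzero input that the next layer requires.\<close>

lemma good_act_ne_0:
  assumes w: "w \<in> good s l" and s: "s > 0"
  shows "\<exists>j<width d N l. act d N w x0 l j \<noteq> 0"
proof (cases l)
  case 0
  then show ?thesis using d_pos by (intro exI[of _ 0]) (simp add: width_def x0_def)
next
  case (Suc m)
  show ?thesis
  proof (rule ccontr)
    assume "\<not> ?thesis"
    then have "relu (pre d N w x0 m i) = 0" if "i < N" for i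
      using that by (auto simp: Suc width_def)
    then have "\<not> pre d N w x0 m i > 0" if "i < N" for i
      using that by (fastforce simp: relu_def)
    then have "tang d N w x0 v l i = 0" if "i < N" for i v
      using that by (simp add: Suc)
    then have "ip (width d N l) (tang d N w x0 v l) (tang d N w x0 v l) = 0" for v
      by (simp add: ip_def Suc width_def)
    then have "(s\<^sup>2) ^ l * ip d (\<lambda>_. 1) (\<lambda>_. 1) \<le> 0"
      using w unfolding good_def by fastforce
    moreover have "(s\<^sup>2) ^ l * ip d (\<lambda>_. 1) (\<lambda>_. 1) > 0"
      using s d_pos by (simp add: ip_def)
    ultimately show False by linarith
  qed
qed

text \<open>With the lower parameters fixed to \<open>w1\<close>, the activations and tangents
  entering layer \<open>l\<close> are constants, so the single-layer estimate applies to them. The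
  event \<open>B\<close> depends on \<open>w1\<close>, its probability bound does not.\<close>

lemma good_step:
  assumes l: "l < L" and w1: "w1 \<in> good s l"
    and r: "0 < r" "r \<le> 4" and s: "s = 1 - 16 / 7 * r" "s > 0"
  shows "\<exists>B\<in>sets (PiM (layer l (width d N l) N) M).
     1 - 96 ^ d * (2 * exp (- real N * r\<^sup>2 / 128)) \<le> measure (PiM (layer l (width d N l) N) M) B \<and>
     (\<forall>w2\<in>B. merge (lower_params d N l) (layer l (width d N l) N) (w1, w2) \<in> good s (Suc l))"
proof -
  interpret G: gaussian_layer M l "width d N l" N
    by unfold_locales (use N_pos gauss_hidden[OF l] in auto)
  let ?n = "width d N l"
  let ?I = "lower_params d N l" and ?J = "layer l ?n N"
  define y where "y = act d N w1 x0 l"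
  define a where "a k j = tang d N w1 x0 (\<lambda>m. if m = k then 1 else 0) l j" for k j
  have y: "\<exists>j<?n. y j \<noteq> 0"
    using good_act_ne_0[OF w1 s(2)] by (simp add: y_def)
  obtain B where B: "B \<in> sets G.P" "measure G.P B \<ge> 1 - 96 ^ d * (2 * exp (- real N * r\<^sup>2 / 128))"
    and ne: "\<And>w i. w \<in> B \<Longrightarrow> i < N \<Longrightarrow> G.preact w y i \<noteq> 0"
    and iso: "\<And>w c. w \<in> B \<Longrightarrow> \<bar>G.energy w y (\<lambda>j. \<Sum>k<d. c k * a k j) - ip ?n (\<lambda>j. \<Sum>k<d. c k * a k j) (\<lambda>j. \<Sum>k<d. c k * a k j)\<bar>
       \<le> 16 / 7 * r * ip ?n (\<lambda>j. \<Sum>k<d. c k * a k j) (\<lambda>j. \<Sum>k<d. c k * a k j)"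
    by (rule G.layer_near_isometry[OF y r, where d = d and a = a]) (rule that)
  have "merge ?I ?J (w1, w2) \<in> good s (Suc l)" if w2: "w2 \<in> B" for w2
  proof -
    define w where "w = merge ?I ?J (w1, w2)"
    have disj: "?I \<inter> ?J = {}"
      by (auto simp: lower_params_def layer_def)
    have w_I: "w k = w1 k" if "k \<in> ?I" for k
      using that by (simp add: w_def merge_def)
    have w_J: "w k = w2 k" if "k \<in> ?J" for k
      using that disj by (auto simp: w_def merge_def)
    have "w1 \<in> space (PiM ?I M)" using w1 by (simp add: good_def)
    moreover have "w2 \<in> space (PiM ?J M)" using w2 B(1) sets.sets_into_space by blast
    ultimately have w_space: "w \<in> space (PiM (lower_params d N (Suc l)) M)"
      unfolding lower_params_Suc w_def by (auto simp: space_PiM PiE_iff merge_def extensional_def)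
    have act_w: "act d N w x0 l j = y j" if "j < ?n" for j
      using act_tang_local[of d N l w w1 j x0 undefined, OF w_I that] by (simp add: y_def)
    have tang_w: "tang d N w x0 v l j = tang d N w1 x0 v l j" if "j < ?n" for j v
      using act_tang_local[of d N l w w1 j x0 v, OF w_I that] by simp
    have row_w: "(\<Sum>j<?n. w (Wt l i j) * z j) = G.row w2 i z" if "i < N" for i z
      unfolding G.row_def using that by (intro sum.cong refl) (simp add: w_J layer_def)
    have pre_w: "pre d N w x0 l i = G.preact w2 y i" if "i < N" for i
    proof -
      have "(\<Sum>j<?n. w (Wt l i j) * act d N w x0 l j) = (\<Sum>j<?n. w (Wt l i j) * y j)"
        by (rule sum.cong) (simp_all add: act_w)
      moreover have "w (Bs l i) = w2 (Bs l i)" using that by (simp add: w_J layer_def)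
      ultimately show ?thesis
        unfolding pre_act G.preact_def using row_w[OF that] by simp
    qed
    have pre_ne: "pre d N w x0 m i \<noteq> 0" if "m < Suc l" "i < N" for m i
    proof (cases "m = l")
      case True
      then show ?thesis using ne[OF w2 that(2)] pre_w[OF that(2)] by simp
    next
      case False
      then have "m < l" using that by simp
      then have "pre d N w x0 m i = pre d N w1 x0 m i"
        using lower_params_mono[of "Suc m" l d N] that(2) by (intro pre_local w_I) auto
      then show ?thesis using w1 \<open>m < l\<close> that(2) by (simp add: good_def)
    qed
    have lower: "(s\<^sup>2) ^ Suc l * ip d v v \<le> ip (width d N (Suc l)) (tang d N w x0 v (Suc l)) (tang d N w x0 v (Suc l))" for v
    proof -
      define z where "z = (\<lambda>j. \<Sum>k<d. v k * a k j)"
      have z: "tang d N w1 x0 v l j = z j" if "j < ?n" for j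
        using tang_linear[OF that, of w1 x0 v] by (simp add: z_def a_def)
      have tang_eq: "tang d N w x0 v (Suc l) i = (if G.preact w2 y i > 0 then G.row w2 i z else 0)" if "i < N" for i
      proof -
        have "(\<Sum>j<?n. w (Wt l i j) * tang d N w x0 v l j) = (\<Sum>j<?n. w (Wt l i j) * z j)"
          by (rule sum.cong) (simp_all add: tang_w z)
        then show ?thesis using pre_w[OF that] row_w[OF that] by simp
      qed
      have width_Suc: "width d N (Suc l) = N" by (simp add: width_def)
      have energy: "ip (width d N (Suc l)) (tang d N w x0 v (Suc l)) (tang d N w x0 v (Suc l)) = G.energy w2 y z"
        unfolding ip_def G.energy_def width_Suc
        by (intro sum.cong refl) (simp add: tang_eq power2_eq_square del: tang.simps)
      have ip_z: "ip ?n (tang d N w1 x0 v l) (tang d N w1 x0 v l) = ip ?n z z"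
        unfolding ip_def by (simp add: z)
      have "(s\<^sup>2) ^ Suc l * ip d v v = s\<^sup>2 * ((s\<^sup>2) ^ l * ip d v v)" by simp
      also have "\<dots> \<le> s\<^sup>2 * ip ?n z z"
        using w1 unfolding good_def by (intro mult_left_mono) (simp_all add: flip: ip_z)
      \<comment> \<open>The layer multiplies squared norms by at least \<open>s\<close>; since 0 < s
        <= 1, this is weakened to s^2, so that norms shrink by the factor \<open>s\<close> of the
        claim.\<close>
      also have "\<dots> \<le> s * ip ?n z z"
        using s r by (intro mult_right_mono) (auto simp: power2_eq_square)
      also have "\<dots> \<le> G.energy w2 y z"
        using iso[OF w2, of v] unfolding z_def[symmetric] s(1) left_diff_distrib by linarith
      finally show ?thesis unfolding energy .
    qed
    have "w \<in> good s (Suc l)"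
      unfolding good_def using w_space pre_ne lower by simp
    then show ?thesis by (simp add: w_def)
  qed
  then show ?thesis using B by blast
qed

lemma measure_good_ge:
  assumes r: "0 < r" "r \<le> 4" and s: "s = 1 - 16 / 7 * r" "s > 0"
    and p: "p = 1 - 96 ^ d * (2 * exp (- real N * r\<^sup>2 / 128))" "p \<ge> 0"
  shows "l \<le> L \<Longrightarrow> p ^ l \<le> measure (PiM (lower_params d N l) M) (good s l)"
proof (induction l)
  case 0
  interpret prob_space "PiM (lower_params d N 0) M" by (rule prob_space_P)
  have "good s 0 = space (PiM (lower_params d N 0) M)"
    by (auto simp: good_def width_def ip_def)
  then show ?case using prob_space by simp
next
  case (Suc l)
  have "p * measure (PiM (lower_params d N l) M) (good s l)
    \<le> measure (PiM (lower_params d N l \<union> layer l (width d N l) N) M) (good s (Suc l))"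
  proof (rule measure_PiM_Un_ge)
    show "lower_params d N l \<inter> layer l (width d N l) N = {}"
      by (auto simp: lower_params_def layer_def)
    show "good s (Suc l) \<in> sets (PiM (lower_params d N l \<union> layer l (width d N l) N) M)"
      using good_sets[of s "Suc l"] by (simp add: lower_params_Suc)
  qed (use good_sets finite_lower_params finite_layer p good_step[OF _ _ r s] Suc.prems in auto)
  moreover have "p * p ^ l \<le> p * measure (PiM (lower_params d N l) M) (good s l)"
    using Suc p by (intro mult_left_mono) auto
  ultimately show ?case by (simp add: lower_params_Suc)
qed

lemma Lip_measurable:
  assumes "lower_params d N L \<subseteq> K" "Bs L 0 \<in> K" "\<And>j. j < width d N L \<Longrightarrow> Wt L 0 j \<in> K"
  shows "(\<lambda>w. Lip d (net d N L w)) \<in> borel_measurable (PiM K M)"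
proof -
  have [measurable]: "(\<lambda>w. net d N L w x) \<in> borel_measurable (PiM K M)" for x
    unfolding net_def by (intro pre_measurable assms)
  have "countable {(x, y). x \<in> rat_vectors d \<and> y \<in> rat_vectors d \<and> x \<noteq> y}"
    by (rule countable_subset[of _ "rat_vectors d \<times> rat_vectors d"]) (auto simp: countable_rat_vectors)
  then show ?thesis
    unfolding Lip_net_eq_rational_SUP by (intro borel_measurable_SUP) (auto simp: split_beta')
qed

text \<open>On the event of the hidden layers, the gradient at \<open>x0\<close> is A^T g, with
  \<open>A\<close> fixed by the hidden parameters and \<open>g\<close> the output weights. The
  singular value bound s^L of \<open>A\<close> enters the output estimate as \<sigma>2 =
  (s^2)^L.\<close>

lemma Lip_lower_bound:
  assumes L: "L \<ge> 1" and r: "0 < r" "r \<le> 4" and s: "s = 1 - 16 / 7 * r" "s > 0"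
    and p: "p = 1 - 96 ^ d * (2 * exp (- real N * r\<^sup>2 / 128))" "p \<ge> 0"
    and t: "0 \<le> t" "t \<le> sqrt (real d)"
    and K: "K = lower_params d N L \<union> insert (Bs L 0) (Wt L 0 ` {..<N})"
  shows "p ^ L * (1 - exp (- t\<^sup>2 / 8))
    \<le> measure (PiM K M) {w\<in>space (PiM K M). ereal (s ^ L * (sqrt (real d) - t)) \<le> Lip d (net d N L w)}"
proof -
  let ?I = "lower_params d N L" and ?J = "insert (Bs L 0) (Wt L 0 ` {..<N})"
  let ?F = "{w\<in>space (PiM K M). ereal (s ^ L * (sqrt (real d) - t)) \<le> Lip d (net d N L w)}"
  have width_L: "width d N L = N" using L by (simp add: width_def)
  have disj: "?I \<inter> ?J = {}" by (auto simp: lower_params_def layer_def)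
  have [measurable]: "(\<lambda>w. Lip d (net d N L w)) \<in> borel_measurable (PiM K M)"
    by (rule Lip_measurable) (auto simp: K width_L)
  have F: "?F \<in> sets (PiM K M)" by measurable
  have step: "\<exists>B\<in>sets (PiM ?J M). 1 - exp (- t\<^sup>2 / 8) \<le> measure (PiM ?J M) B \<and> (\<forall>w2\<in>B. merge ?I ?J (w1, w2) \<in> ?F)"
    if w1: "w1 \<in> good s L" for w1
  proof -
    define a where "a k j = tang d N w1 x0 (\<lambda>m. if m = k then 1 else 0) L j" for k j
    define B where "B = {w\<in>space (PiM ?J M). (\<Sum>k<d. (\<Sum>j<N. w (Wt L 0 j) * a k j)\<^sup>2) > (s\<^sup>2) ^ L * (sqrt (real d) - t)\<^sup>2}"
    have "(s\<^sup>2) ^ L * ip d v v \<le> ip N (\<lambda>j. \<Sum>k<d. v k * a k j) (\<lambda>j. \<Sum>k<d. v k * a k j)" for v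
    proof -
      have "tang d N w1 x0 v L j = (\<Sum>k<d. v k * a k j)" if "j < N" for j
        unfolding a_def using tang_linear[of j d N L w1 x0 v] that by (simp add: width_L)
      then have eq: "ip N (tang d N w1 x0 v L) (tang d N w1 x0 v L) = ip N (\<lambda>j. \<Sum>k<d. v k * a k j) (\<lambda>j. \<Sum>k<d. v k * a k j)"
        unfolding ip_def by simp
      have "(s\<^sup>2) ^ L * ip d v v \<le> ip N (tang d N w1 x0 v L) (tang d N w1 x0 v L)"
        using w1 by (simp add: good_def width_L)
      then show ?thesis unfolding eq .
    qed
    then have B_prob: "1 - exp (- t\<^sup>2 / 8) \<le> measure (PiM ?J M) B"
      unfolding B_def using s d_pos t gauss_out
      by (intro gaussian_adjoint_tail) (auto simp: inj_on_def)
    have [measurable]: "(\<lambda>w. \<Sum>k<d. (\<Sum>j<N. w (Wt L 0 j) * a k j)\<^sup>2) \<in> borel_measurable (PiM ?J M)"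
      by (intro borel_measurable_sum borel_measurable_power borel_measurable_times coordinate_measurable) auto
    have B_sets: "B \<in> sets (PiM ?J M)" unfolding B_def by measurable
    have "merge ?I ?J (w1, w2) \<in> ?F" if w2: "w2 \<in> B" for w2
    proof -
      define w where "w = merge ?I ?J (w1, w2)"
      have w_I: "w k = w1 k" if "k \<in> ?I" for k
        using that by (simp add: w_def merge_def)
      have w_J: "w k = w2 k" if "k \<in> ?J" for k
        using that disj by (auto simp: w_def merge_def)
      have "w1 \<in> space (PiM ?I M)" "w2 \<in> space (PiM ?J M)"
        using w1 w2 by (auto simp: good_def B_def)
      then have w_space: "w \<in> space (PiM K M)"
        unfolding K w_def by (auto simp: space_PiM PiE_iff merge_def extensional_def)
      have pre_ne: "pre d N w x0 m i \<noteq> 0" if "m < L" "i < N" for m i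
      proof -
        have "pre d N w x0 m i = pre d N w1 x0 m i"
          using lower_params_mono[of "Suc m" L d N] that by (intro pre_local w_I) auto
        then show ?thesis using w1 that by (simp add: good_def)
      qed
      define g where "g k = (\<Sum>j<width d N L. w (Wt L 0 j) * tang d N w x0 (\<lambda>m. if m = k then 1 else 0) L j)" for k
      have g: "g k = (\<Sum>j<N. w2 (Wt L 0 j) * a k j)" for k
        unfolding g_def width_L
      proof (rule sum.cong)
        fix j assume "j \<in> {..<N}"
        then have "w (Wt L 0 j) = w2 (Wt L 0 j)" by (intro w_J) auto
        moreover have "tang d N w x0 (\<lambda>m. if m = k then 1 else 0) L j = a k j"
          unfolding a_def using act_tang_local[of d N L w w1 j x0 "\<lambda>m. if m = k then 1 else 0", OF w_I] \<open>j \<in> {..<N}\<close>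
          by (simp add: width_L)
        ultimately show "w (Wt L 0 j) * tang d N w x0 (\<lambda>m. if m = k then 1 else 0) L j = w2 (Wt L 0 j) * a k j"
          by simp
      qed simp
      have "(s ^ L * (sqrt (real d) - t))\<^sup>2 = (s\<^sup>2) ^ L * (sqrt (real d) - t)\<^sup>2"
        by (simp add: power_mult_distrib flip: power_mult) (simp add: mult.commute)
      also have "\<dots> \<le> (\<Sum>k<d. (g k)\<^sup>2)"
        using w2 by (simp add: B_def g)
      finally have "s ^ L * (sqrt (real d) - t) \<le> enorm d g"
        unfolding enorm_def by (rule real_le_rsqrt)
      then have "ereal (s ^ L * (sqrt (real d) - t)) \<le> ereal (enorm d g)" by simp
      also have "\<dots> \<le> Lip d (net d N L w)"
        unfolding g_def by (intro Lip_ge_gradient d_pos pre_ne) (simp add: x0_def Rvec_def PiE_iff extensional_def)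
      finally show ?thesis using w_space by (simp add: w_def)
    qed
    then show ?thesis using B_prob B_sets by blast
  qed
  have "(1 - exp (- t\<^sup>2 / 8)) * measure (PiM ?I M) (good s L) \<le> measure (PiM (?I \<union> ?J) M) ?F"
    using F unfolding K
    by (intro measure_PiM_Un_ge disj finite_lower_params good_sets step[unfolded K]) auto
  moreover have "(1 - exp (- t\<^sup>2 / 8)) * p ^ L \<le> (1 - exp (- t\<^sup>2 / 8)) * measure (PiM ?I M) (good s L)"
    using measure_good_ge[OF r s p, of L] by (intro mult_left_mono) auto
  ultimately show ?thesis by (simp add: K mult.commute)
qed

end


section \<open>Choice of constants and reduction to the nondegenerate case\<close>

theorem theorem6p7:
  shows "\<exists>C c\<^sub>1 :: real. C > 0 \<and> c\<^sub>1 > 0 \<and>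
    (\<forall>(d::nat) (N::nat) (L::nat) (D :: nat \<Rightarrow> nat \<Rightarrow> real measure).
       d \<ge> 1 \<longrightarrow> N \<ge> 1 \<longrightarrow> L \<ge> 1 \<longrightarrow>
       (\<forall>l i. Bs l i \<in> params d N L \<longrightarrow> symmetric_dist (D l i)) \<longrightarrow>
       (\<forall>u t :: real. u \<ge> 0 \<longrightarrow> t \<ge> 0 \<longrightarrow>
          measure (net_law d N L D)
            {w \<in> space (net_law d N L D).
               ereal ((max 0 (1 - C * (sqrt (real d) + u) / sqrt (real N))) ^ L
                       * (sqrt (real (min d N)) - t))
               \<le> Lip d (net d N L w)}
          \<ge> (max 0 (1 - 1 / 2 ^ N - exp (- u\<^sup>2))) ^ L * max 0 (1 - 2 * exp (- c\<^sub>1 * t\<^sup>2))))"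
proof (rule exI[of _ 200], rule exI[of _ "1 / 8"], intro conjI allI impI)
  fix d N L :: nat and D :: "nat \<Rightarrow> nat \<Rightarrow> real measure" and u t :: real
  assume d: "d \<ge> 1" and N: "N \<ge> 1" and L: "L \<ge> 1"
    and D: "\<forall>l i. Bs l i \<in> params d N L \<longrightarrow> symmetric_dist (D l i)" and u: "u \<ge> 0" and t: "t \<ge> 0"
  \<comment> \<open>The laws \<open>D\<close> are constrained only at biases of the network, while
    the locales ask for symmetry at every index; a standard Gaussian is the default
    elsewhere.\<close>
  define M where "M k = (if k \<in> params d N L then param_dist N L D k else gauss 1)" for k
  have M_symm: "symmetric_dist (M k)" for k
    using D N by (cases k) (auto simp: M_def intro!: symmetric_dist_gauss)
  have law: "net_law d N L D = PiM (params d N L) M"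
    unfolding net_law_def by (intro PiM_cong) (auto simp: M_def)
  have params: "params d N L = lower_params d N L \<union> insert (Bs L 0) (Wt L 0 ` {..<N})"
  proof (rule set_eqI)
    fix k
    show "k \<in> params d N L \<longleftrightarrow> k \<in> lower_params d N L \<union> insert (Bs L 0) (Wt L 0 ` {..<N})"
    proof (cases k)
      case (Wt l i j)
      then show ?thesis
        using L by (cases "l = 0") (auto simp: params_def lower_params_def layer_def width_def)
    next
      case (Bs l i)
      then show ?thesis
        by (auto simp: params_def lower_params_def layer_def)
    qed
  qed
  interpret gaussian_network M d N L
  proof (intro gaussian_network.intro symmetric_params.intro symmetric_params_axioms.intro
      product_sigma_finite.intro gaussian_network_axioms.intro d N M_symm)
    show "sigma_finite_measure (M k)" for k
      using M_symm[of k] by (intro prob_space_imp_sigma_finite) (simp add: symmetric_dist_def)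
    show "M (Wt l i j) = gauss (sqrt (2 / real N))" if "l < L" "i < N" "j < width d N l" for l i j
      using that Wt_in_lower_params[OF that] by (simp add: M_def params)
    show "M (Wt L 0 j) = gauss 1" if "j < N" for j
      using that by (simp add: M_def params)
  qed
  let ?P = "PiM (params d N L) M"
  interpret prob_space ?P by (rule prob_space_P)
  define s where "s = 1 - 200 * (sqrt (real d) + u) / sqrt (real N)"
  define q where "q = 1 - 1 / 2 ^ N - exp (- u\<^sup>2)"
  define b where "b = 1 - 2 * exp (- (1 / 8) * t\<^sup>2)"
  have "0 \<le> 1 / (2::real) ^ N" by simp
  then have q1: "q \<le> 1" unfolding q_def using exp_ge_zero[of "- u\<^sup>2"] by linarith
  have b1: "b \<le> 1" by (simp add: b_def)
  have rhs_le_1: "max 0 q ^ L * max 0 b \<le> 1"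
    using q1 b1 by (intro mult_le_one power_le_one) auto
  have "max 0 q ^ L * max 0 b
     \<le> measure (net_law d N L D) {w \<in> space (net_law d N L D).
         ereal (max 0 s ^ L * (sqrt (real (min d N)) - t)) \<le> Lip d (net d N L w)}"
    unfolding law
  proof (cases "s > 0 \<and> t \<le> sqrt (real (min d N))")
    case False
    \<comment> \<open>If \<open>s\<close> <= 0, then L >= 1 makes the power zero. The event is then
      the whole space, and the bound on its probability is at most 1.\<close>
    then have "max 0 s ^ L * (sqrt (real (min d N)) - t) \<le> 0"
      using L by (auto simp: max_def not_less power_0_left intro: mult_nonneg_nonpos)
    then have "ereal (max 0 s ^ L * (sqrt (real (min d N)) - t)) \<le> Lip d (net d N L w)" for w
      by (intro order_trans[OF _ Lip_nonneg[OF d]]) (simp only: zero_ereal_def ereal_less_eq)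
    then show "max 0 q ^ L * max 0 b \<le> measure ?P {w \<in> space ?P.
         ereal (max 0 s ^ L * (sqrt (real (min d N)) - t)) \<le> Lip d (net d N L w)}"
      using rhs_le_1 by (simp add: prob_space)
  next
    case True
    define \<delta> where "\<delta> = (sqrt (real d) + u) / sqrt (real N)"
    have s_\<delta>: "s = 1 - 200 * \<delta>" by (simp add: s_def \<delta>_def)
    have \<delta>0: "\<delta> > 0" using d N u by (auto simp: \<delta>_def intro!: divide_pos_pos add_pos_nonneg)
    have \<delta>1: "200 * \<delta> < 1" using True by (simp add: s_\<delta>)
    \<comment> \<open>Positivity of \<open>s\<close> makes \<open>d\<close> < \<open>N\<close>, so
      that the minimum in the claim is \<open>d\<close>.\<close>
    have "sqrt (real d) + u < sqrt (real N)"
      using \<delta>1 \<delta>0 N by (simp add: \<delta>_def field_simps)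
    then have "sqrt (real d) < sqrt (real N)" using u by linarith
    then have min: "min d N = d" by simp
    define r where "r = 175 / 2 * \<delta>" \<comment> \<open>\<open>7/16 * 200 * \<delta>\<close>\<close>
    have r: "0 < r" "r \<le> 4" using \<delta>0 \<delta>1 by (auto simp: r_def)
    have s_r: "s = 1 - 16 / 7 * r" by (simp add: s_\<delta> r_def)
    define p where "p = 1 - 96 ^ d * (2 * exp (- real N * r\<^sup>2 / 128))"
    \<comment> \<open>Since 96^d <= exp (7 d) and 2 <= exp d, an exponent of at least 8 d + u^2
      suffices. By (sqrt d + u)^2 >= d + u^2, the choice of 200 yields at least 59 (d +
      u^2).\<close>
    have "96 ^ d * (2 * exp (- real N * r\<^sup>2 / 128)) \<le> exp (- u\<^sup>2)"
    proof -
      have e2: "(2::real) \<le> exp 1" using exp_ge_add_one_self[of 1] by simp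
      have "(96::real) \<le> 2 ^ 7" by simp
      also have "\<dots> \<le> exp 1 ^ 7" using e2 by (intro power_mono) auto
      also have "\<dots> = exp 7" by (simp flip: exp_of_nat_mult)
      finally have "(96::real) ^ d \<le> exp 7 ^ d" by (intro power_mono) auto
      also have "exp 7 ^ d = exp (7 * real d)" by (simp add: mult.commute flip: exp_of_nat_mult)
      finally have 96: "(96::real) ^ d \<le> exp (7 * real d)" .
      have "(2::real) \<le> exp (real d)"
        using e2 d by (intro order_trans[OF e2]) simp
      moreover have "real N * r\<^sup>2 / 128 \<ge> 8 * real d + u\<^sup>2"
      proof -
        have "real N * \<delta>\<^sup>2 = (sqrt (real d) + u)\<^sup>2"
          using N by (simp add: \<delta>_def power_divide)
        also have "\<dots> \<ge> real d + u\<^sup>2"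
          using u by (simp add: power2_sum)
        finally have "real N * \<delta>\<^sup>2 \<ge> real d + u\<^sup>2" .
        moreover have "real N * r\<^sup>2 / 128 = 30625 / 512 * (real N * \<delta>\<^sup>2)"
          by (simp add: r_def power2_eq_square)
        moreover have "u\<^sup>2 \<ge> 0" by simp
        ultimately show ?thesis by linarith
      qed
      then have "exp (- real N * r\<^sup>2 / 128) \<le> exp (- (8 * real d + u\<^sup>2))" by simp
      ultimately have "96 ^ d * (2 * exp (- real N * r\<^sup>2 / 128)) \<le> exp (7 * real d) * (exp (real d) * exp (- (8 * real d + u\<^sup>2)))"
        using 96 by (intro mult_mono) auto
      also have "\<dots> = exp (- u\<^sup>2)" by (simp flip: exp_add)
      finally show ?thesis .
    qed
    then have p: "p \<ge> 1 - exp (- u\<^sup>2)" by (simp add: p_def)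
    moreover have "1 - exp (- u\<^sup>2) \<ge> 0" by simp
    ultimately have p0: "p \<ge> 0" by linarith
    \<comment> \<open>The comparison is factor by factor: 1 - exp (- u^2) lies between
      \<open>q\<close> and \<open>p\<close>, and 1/8 is the exponent constant of the output
      estimate.\<close>
    have "max 0 q ^ L * max 0 b \<le> p ^ L * (1 - exp (- t\<^sup>2 / 8))"
    proof (intro mult_mono power_mono)
      show "max 0 q \<le> p" using p p0 by (auto simp: q_def intro: order_trans[rotated])
      show "max 0 b \<le> 1 - exp (- t\<^sup>2 / 8)" by (simp add: b_def)
    qed (use p0 in auto)
    also have "\<dots> \<le> measure ?P {w \<in> space ?P. ereal (s ^ L * (sqrt (real d) - t)) \<le> Lip d (net d N L w)}"
      using True by (intro Lip_lower_bound[OF L r s_r _ p_def p0 t _ params]) (auto simp: min)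
    finally show "max 0 q ^ L * max 0 b \<le> measure ?P {w \<in> space ?P.
         ereal (max 0 s ^ L * (sqrt (real (min d N)) - t)) \<le> Lip d (net d N L w)}"
      using True by (simp add: min)
  qed
  then show "measure (net_law d N L D)
      {w \<in> space (net_law d N L D).
         ereal ((max 0 (1 - 200 * (sqrt (real d) + u) / sqrt (real N))) ^ L * (sqrt (real (min d N)) - t))
         \<le> Lip d (net d N L w)}
    \<ge> (max 0 (1 - 1 / 2 ^ N - exp (- u\<^sup>2))) ^ L * max 0 (1 - 2 * exp (- (1 / 8) * t\<^sup>2))"
    unfolding q_def b_def s_def .
qed simp_all

end
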